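(* Let $\alpha\in\mathbb R$, let $m\in\mathbb N_0$, let $(s_j)_{j=0}^m\in\mathcal K^{\ge}_{q,m,\alpha}$, and let $k$ be an integer with $0\le k\le m$. Let $(t_j)_{j=0}^{m-k}$ be the $k$-th $\alpha$-Schur transform of $(s_j)_{j=0}^m$, and let $(Q_j)_{j=0}^m$ and $(T_j)_{j=0}^{m-k}$ be the right $\alpha$-Stieltjes parametrizations of $(s_j)_{j=0}^m$ and $(t_j)_{j=0}^{m-k}$, respectively. Then $$T_{m-k}=\begin{cases}Q_m,&\text{if }k=0,\\ Q_m-\sum_{r=0}^{k-1}E_{m-r,r},&\text{if }k\ge1,\end{cases}$$ and, in the case $k<m$, furthermore $T_j=Q_{k+j}$ for all integers $j$ with $0\le j\le m-k-1$.
   Context: Let $q\in\mathbb N=\{1,2,\dots\}$; $\mathbb N_0=\{0,1,2,\dots\}$. All sequences consist of complex $q\times q$ matrices. $A\ge0$ means that $A$ is nonnegative Hermitian (Hermitian positive semidefinite), and $A^\dagger$ is the Moore–Penrose inverse of $A$. Block Hankel matrices. For a sequence $(s_j)$ put $H_n=[s_{j+k}]_{j,k=0}^n$, $s_{\alpha,j}=-\alpha s_j+s_{j+1}$, and $H_{\alpha,n}=[s_{\alpha,j+k}]_{j,k=0}^n$ (whenever the entries are available). Classes. $\mathcal K^{\ge}_{q,0,\alpha}$ is the set of all $(s_j)_{j=0}^0$ with $s_0\ge0$. For $n\ge1$, $\mathcal K^{\ge}_{q,2n,\alpha}$ is the set of all $(s_j)_{j=0}^{2n}$ with $H_n\ge0$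 and $H_{\alpha,n-1}\ge0$. For $n\ge0$, $\mathcal K^{\ge}_{q,2n+1,\alpha}$ is the set of all $(s_j)_{j=0}^{2n+1}$ with $H_n\ge0$ and $H_{\alpha,n}\ge0$. Right $\alpha$-Stieltjes parametrization. Put $L_0=s_0$ and, for $n\ge1$, $L_n=s_{2n}-[s_n,\dots,s_{2n-1}]\,H_{n-1}^\dagger\,\begin{bmatrix}s_n\\ \vdots\\ s_{2n-1}\end{bmatrix}$; let $L_{\alpha,n}$ be the matrix built in the same way from the sequence $(s_{\alpha,j})$ in place of $(s_j)$ (so $L_{\alpha,0}=s_{\alpha,0}$). The right $\alpha$-Stieltjes parametrization $(Q_j)$ of $(s_j)$ is given by $Q_{2k}=L_k$ and $Q_{2k+1}=L_{\alpha,k}$. $\alpha$-Schur transforms. The $[+,\alpha]$-transform of $(s_j)$ is $(u_j)$ with $u_j=-\alpha s_{j-1}+s_j$, where $s_{-1}=0$. The reciprocal sequence of a sequence $(u_j)$ is given by $u_0^\sharp=u_0^\dagger$ and $u_j^\sharp=-u_0^\dagger\sum_{l=0}^{j-1}u_{j-l}u_l^\sharp$ for $j\ge1$. Put $s_j^{\sharp,\alpha}=u_j^\sharp$ where $(u_j)$ is the $[+,\alpha]$-transform of $(s_j)$. The first $\alpha$-Schur transform of a sequence $(s_j)_{j=0}^{\kappa}$ with $\kappa\ge1$ is $(s_j^{[1,\alpha]})_{j=0}^{\kappa-1}$ with $s_j^{[1,\alpha]}=-s_0\,s_{j+1}^{\sharp,\alpha}\,s_0$. The $0$-th $\alpha$-Schur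 transform of $(s_j)$ is $(s_j)$ itself, and for $k\ge1$ the $k$-th $\alpha$-Schur transform $(s_j^{[k,\alpha]})_{j=0}^{\kappa-k}$ is the first $\alpha$-Schur transform of the $(k-1)$-th one. Defect matrices. $E_{j,k}=s_j^{[k,\alpha]}-s_0^{[k,\alpha]}(s_0^{[k,\alpha]})^\dagger s_j^{[k,\alpha]}(s_0^{[k,\alpha]})^\dagger s_0^{[k,\alpha]}$ for $0\le k\le m$ and $0\le j\le m-k$. *)

theory Defs
  imports "Jordan_Normal_Form.Schur_Decomposition"
begin

text \<open>A finite sequence of complex q x q matrices with indices 0, ..., m is encoded as a function
  of type \<^typ>\<open>nat \<Rightarrow> complex mat\<close> of which only the values at indices at most m matter.
  All operations below compute their j-th output from entries whose indices lie in the range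
  available for the finite sequence.\<close>

definition nonneg_hermitian :: "complex mat \<Rightarrow> bool" where
  "nonneg_hermitian A \<longleftrightarrow>
     square_mat A \<and> mat_adjoint A = A \<and>
     (\<forall>v \<in> carrier_vec (dim_row A). (A *\<^sub>v v) \<bullet>c v \<in> \<real> \<and> 0 \<le> Re ((A *\<^sub>v v) \<bullet>c v))"

definition is_moore_penrose :: "complex mat \<Rightarrow> complex mat \<Rightarrow> bool" where
  "is_moore_penrose A X \<longleftrightarrow>
     X \<in> carrier_mat (dim_col A) (dim_row A) \<and>
     A * X * A = A \<and> X * A * X = X \<and>
     mat_adjoint (A * X) = A * X \<and> mat_adjoint (X * A) = X * A"

definition pinv :: "complex mat \<Rightarrow> complex mat" where
  "pinv A = (THE X. is_moore_penrose A X)"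

text \<open>The type of matrices of arbitrary size is not a monoid under addition, hence an
  explicit finite sum of q x q matrices.\<close>

definition msum :: "nat \<Rightarrow> (nat \<Rightarrow> complex mat) \<Rightarrow> nat set \<Rightarrow> complex mat" where
  "msum q f I = mat q q (\<lambda>(i, j). \<Sum>r\<in>I. f r $$ (i, j))"

lemma msum_cong [fundef_cong]:
  "q = q' \<Longrightarrow> I = I' \<Longrightarrow> (\<And>r. r \<in> I' \<Longrightarrow> f r = g r) \<Longrightarrow> msum q f I = msum q' g I'"
  by (simp add: msum_def)

text \<open>Block matrix with a x b blocks \<open>B j k\<close>, each of size q x q.\<close>

definition block_mat :: "nat \<Rightarrow> nat \<Rightarrow> nat \<Rightarrow> (nat \<Rightarrow> nat \<Rightarrow> complex mat) \<Rightarrow> complex mat" where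
  "block_mat q a b B =
     mat (a * q) (b * q) (\<lambda>(i, j). B (i div q) (j div q) $$ (i mod q, j mod q))"

definition block_hankel :: "nat \<Rightarrow> (nat \<Rightarrow> complex mat) \<Rightarrow> nat \<Rightarrow> complex mat" where
  "block_hankel q s n = block_mat q (n + 1) (n + 1) (\<lambda>j k. s (j + k))"

definition shifted :: "real \<Rightarrow> (nat \<Rightarrow> complex mat) \<Rightarrow> nat \<Rightarrow> complex mat" where
  "shifted \<alpha> s j = (- complex_of_real \<alpha>) \<cdot>\<^sub>m s j + s (j + 1)"

definition stieltjes_class :: "nat \<Rightarrow> nat \<Rightarrow> real \<Rightarrow> (nat \<Rightarrow> complex mat) set" where
  "stieltjes_class q m \<alpha> = {s. (\<forall>j\<le>m. s j \<in> carrier_mat q q) \<and>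
     (if m = 0 then nonneg_hermitian (s 0)
      else if even m then
        nonneg_hermitian (block_hankel q s (m div 2)) \<and>
        nonneg_hermitian (block_hankel q (shifted \<alpha> s) (m div 2 - 1))
      else
        nonneg_hermitian (block_hankel q s (m div 2)) \<and>
        nonneg_hermitian (block_hankel q (shifted \<alpha> s) (m div 2)))}"

definition schur_L :: "nat \<Rightarrow> (nat \<Rightarrow> complex mat) \<Rightarrow> nat \<Rightarrow> complex mat" where
  "schur_L q s n =
     (if n = 0 then s 0
      else s (2 * n) -
        block_mat q 1 n (\<lambda>_ k. s (n + k)) * pinv (block_hankel q s (n - 1)) *
        block_mat q n 1 (\<lambda>j _. s (n + j)))"

definition stieltjes_param :: "nat \<Rightarrow> real \<Rightarrow> (nat \<Rightarrow> complex mat) \<Rightarrow> nat \<Rightarrow> complex mat" where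
  "stieltjes_param q \<alpha> s j =
     (if even j then schur_L q s (j div 2) else schur_L q (shifted \<alpha> s) (j div 2))"

text \<open>The entry of the sequence with index -1 is by convention zero.\<close>

definition plus_transform :: "nat \<Rightarrow> real \<Rightarrow> (nat \<Rightarrow> complex mat) \<Rightarrow> nat \<Rightarrow> complex mat" where
  "plus_transform q \<alpha> s j =
     (- complex_of_real \<alpha>) \<cdot>\<^sub>m (if j = 0 then 0\<^sub>m q q else s (j - 1)) + s j"

function reciprocal :: "nat \<Rightarrow> (nat \<Rightarrow> complex mat) \<Rightarrow> nat \<Rightarrow> complex mat" where
  "reciprocal q u j =
     (if j = 0 then pinv (u 0)
      else - (pinv (u 0) * msum q (\<lambda>l. u (j - l) * reciprocal q u l) {..<j}))"
  by auto
termination by (relation "measure (\<lambda>(q, u, j). j)") auto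

declare reciprocal.simps [simp del]

definition schur_transform1 :: "nat \<Rightarrow> real \<Rightarrow> (nat \<Rightarrow> complex mat) \<Rightarrow> nat \<Rightarrow> complex mat" where
  "schur_transform1 q \<alpha> s j = - (s 0 * reciprocal q (plus_transform q \<alpha> s) (j + 1) * s 0)"

primrec schur_transform ::
  "nat \<Rightarrow> real \<Rightarrow> nat \<Rightarrow> (nat \<Rightarrow> complex mat) \<Rightarrow> nat \<Rightarrow> complex mat" where
  "schur_transform q \<alpha> 0 s = s"
| "schur_transform q \<alpha> (Suc k) s = schur_transform1 q \<alpha> (schur_transform q \<alpha> k s)"

definition defect :: "nat \<Rightarrow> real \<Rightarrow> (nat \<Rightarrow> complex mat) \<Rightarrow> nat \<Rightarrow> nat \<Rightarrow> complex mat" where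
  "defect q \<alpha> s j k =
     (let t = schur_transform q \<alpha> k s
      in t j - t 0 * pinv (t 0) * t j * pinv (t 0) * t 0)"

end

theory Submission
  imports Defs "HOL-Computational_Algebra.Formal_Power_Series"
begin

text \<open>The matrices \<open>L_n\<close> and \<open>L_{\<alpha>,n}\<close> are remainders of Pade approximation, and the Schur transform acts on
  Pade approximants by an explicit substitution that keeps these remainders.

  Encode a sequence \<open>h\<close> by the matrix power series \<open>h(X) = \<Sum>j. h_j X^j\<close>. Let \<open>W\<close> be a polynomial of
  degree at most \<open>n\<close> with \<open>W(0) = 1\<close> and \<open>h(X) W(X) = N(X) + L X^(2n) + O(X^(2n+1))\<close>, where \<open>N\<close> has degree
  less than \<open>n\<close>. The coefficients of \<open>W\<close> in reverse order form a block column which the block Hankel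
  matrix \<open>H_n\<close> sends to the column \<open>(0, ..., 0, L)\<close>, so that \<open>L\<close> is the Schur complement of \<open>H_{n-1}\<close> in
  \<open>H_n\<close>. By Albert's criterion for block matrices, \<open>H_n \<ge> 0\<close> holds if and only if such a remainder
  exists and is nonnegative for each \<open>i \<le> n\<close> (\<open>hankel_nonneg_iff\<close>), and it then is \<open>L_i\<close>
  (\<open>schur_L_eq_pade_remainder\<close>). Membership in the class and the parameters can both be read off from
  Pade remainders.

  Let \<open>P = s_0 s_0\<^sup>\<dagger>\<close> be the orthogonal projection onto the range of \<open>s_0\<close>, and assume first that
  \<open>P s_j = s_j\<close> for all \<open>j\<close>. The recursion for the reciprocal sequence then says that the series of
  \<open>(u_j)\<close> and of its reciprocal are inverse to each other in the corner ring with unit \<open>P\<close>. Therefore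
  the first Schur transform \<open>t\<close> satisfies \<open>t(X) s_0\<^sup>\<dagger> (1 - \<alpha>X) s(X) = s_\<alpha>(X)\<close> (\<open>T_D_U\<close>). If \<open>W\<close> and \<open>N\<close>
  belong to \<open>s_\<alpha>\<close>, then \<open>s_0\<^sup>\<dagger> (s_0 W + X N) + (1 - P)\<close> is a Pade denominator of the same degree for \<open>t\<close>,
  with the same remainder; if they belong to \<open>s\<close>, then \<open>s_0\<^sup>\<dagger> N + (1 - P)\<close> is a denominator for
  \<open>t_\<alpha>\<close>, of degree one less and again with the same remainder. This is one step of a continued
  fraction. It gives \<open>L_n(t) = L_{\<alpha>,n}(s)\<close> and \<open>L_{\<alpha>,n}(t) = L_{n+1}(s)\<close>, that is \<open>T_j = Q_{j+1}\<close>, and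
  it shows that \<open>t\<close> belongs to the class again.

  For a general \<open>s\<close> in the class, positivity forces \<open>P s_j = s_j = s_j P\<close> for \<open>j < m\<close>; only the last
  entry can violate this. Replacing \<open>s_m\<close> by \<open>P s_m P\<close> is harmless: the sequence stays in the class, its
  Schur transform does not change, and only the last parameter \<open>Q_m\<close> changes, by exactly the defect
  \<open>s_m - P s_m P\<close>. This is \<open>schur_step\<close>, and induction on \<open>k\<close> adds up the defects.\<close>

section \<open>Schur complements of positive semidefinite block matrices\<close>

lemma minus_zero_imp_eq_mat:
  assumes "A \<in> carrier_mat n m" "B \<in> carrier_mat n m" "A - B = (0\<^sub>m n m :: complex mat)"
  shows "A = B"
proof (rule eq_matI)
  fix i j assume "i < dim_row B" "j < dim_col B"
  then show "A $$ (i, j) = B $$ (i, j)"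
    using arg_cong[OF assms(3), of "\<lambda>X. X $$ (i, j)"] assms(1,2) by auto
qed (use assms in auto)

lemma adjoint_index [simp]:
  "dim_row (mat_adjoint A) = dim_col A"
  "dim_col (mat_adjoint A) = dim_row A"
  "i < dim_col A \<Longrightarrow> j < dim_row A \<Longrightarrow> mat_adjoint A $$ (i, j) = conjugate (A $$ (j, i))"
  by (auto simp: mat_adjoint_def mat_of_rows_def)

lemma adjoint_carrier [simp]: "A \<in> carrier_mat n m \<Longrightarrow> mat_adjoint A \<in> carrier_mat m n"
  by (intro carrier_matI) auto

lemma adjoint_adjoint [simp]: "mat_adjoint (mat_adjoint A) = A"
  by (rule eq_matI) auto

lemma adjoint_one [simp]: "mat_adjoint (1\<^sub>m n) = (1\<^sub>m n :: complex mat)"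
  by (rule eq_matI) auto

lemma adjoint_zero [simp]: "mat_adjoint (0\<^sub>m n m) = (0\<^sub>m m n :: complex mat)"
  by (rule eq_matI) auto

lemma adjoint_add:
  "A \<in> carrier_mat n m \<Longrightarrow> B \<in> carrier_mat n m \<Longrightarrow>
    mat_adjoint (A + B) = mat_adjoint A + mat_adjoint (B :: complex mat)"
  by (rule eq_matI) auto

lemma adjoint_minus:
  "A \<in> carrier_mat n m \<Longrightarrow> B \<in> carrier_mat n m \<Longrightarrow>
    mat_adjoint (A - B) = mat_adjoint A - mat_adjoint (B :: complex mat)"
  by (rule eq_matI) auto

lemma adjoint_uminus: "mat_adjoint (- A) = - mat_adjoint (A :: complex mat)"
  by (rule eq_matI) auto

lemma adjoint_smult:
  "mat_adjoint (c \<cdot>\<^sub>m A) = cnj c \<cdot>\<^sub>m mat_adjoint (A :: complex mat)"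
  by (rule eq_matI) auto

lemma adjoint_mult:
  assumes "A \<in> carrier_mat n m" "B \<in> carrier_mat m l"
  shows "mat_adjoint (A * B) = mat_adjoint B * mat_adjoint (A :: complex mat)"
  by (rule eq_matI) (use assms in \<open>auto simp: scalar_prod_def mult.commute\<close>)

lemma adjoint_four_block:
  assumes "A \<in> carrier_mat n m" "B \<in> carrier_mat n l" "C \<in> carrier_mat k m" "D \<in> carrier_mat k l"
  shows "mat_adjoint (four_block_mat A B C D) =
    four_block_mat (mat_adjoint A) (mat_adjoint C) (mat_adjoint B) (mat_adjoint (D :: complex mat))"
  by (rule eq_matI) (use assms in auto)

lemma adjoint_mult_vec:
  assumes "X \<in> carrier_mat n m" "v \<in> carrier_vec m" "w \<in> carrier_vec n"
  shows "(X *\<^sub>v v) \<bullet>c w = v \<bullet>c (mat_adjoint (X :: complex mat) *\<^sub>v w)"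
proof -
  have "(X *\<^sub>v v) \<bullet>c w = (\<Sum>i<n. \<Sum>j<m. X $$ (i, j) * v $ j * cnj (w $ i))"
    using assms by (auto simp: scalar_prod_def sum_distrib_right lessThan_atLeast0 intro!: sum.cong)
  also have "\<dots> = (\<Sum>j<m. \<Sum>i<n. X $$ (i, j) * v $ j * cnj (w $ i))"
    by (rule sum.swap)
  also have "\<dots> = v \<bullet>c (mat_adjoint X *\<^sub>v w)"
    using assms by (auto simp: scalar_prod_def sum_distrib_left lessThan_atLeast0 intro!: sum.cong)
  finally show ?thesis .
qed

lemma nonneg_hermitian_iff:
  assumes A: "A \<in> carrier_mat n n"
  shows "nonneg_hermitian A \<longleftrightarrow>
    mat_adjoint A = A \<and> (\<forall>v \<in> carrier_vec n. 0 \<le> Re ((A *\<^sub>v v) \<bullet>c v))"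
proof -
  have "(A *\<^sub>v v) \<bullet>c v \<in> \<real>" if h: "mat_adjoint A = A" and v: "v \<in> carrier_vec n" for v
  proof -
    have Av: "A *\<^sub>v v \<in> carrier_vec n" using A v by simp
    have "cnj ((A *\<^sub>v v) \<bullet>c v) = v \<bullet>c (A *\<^sub>v v)"
      using conjugate_sprod_vec[OF Av, of "conjugate v"] v Av
        conjugate_vec_sprod_comm[OF v Av] by simp
    also have "\<dots> = (A *\<^sub>v v) \<bullet>c v"
      using adjoint_mult_vec[OF A v v] h by simp
    finally show ?thesis by (simp add: Reals_cnj_iff)
  qed
  then show ?thesis using A unfolding nonneg_hermitian_def by (auto simp: square_mat.simps)
qed

lemma nonneg_hermitian_congruence:
  assumes A: "A \<in> carrier_mat n n" and X: "X \<in> carrier_mat n m" and nn: "nonneg_hermitian A"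
  shows "nonneg_hermitian (mat_adjoint X * A * X)"
proof -
  have c: "mat_adjoint X * A * X \<in> carrier_mat m m" using A X by auto
  have "((mat_adjoint X * A * X) *\<^sub>v v) \<bullet>c v = (A *\<^sub>v (X *\<^sub>v v)) \<bullet>c (X *\<^sub>v v)"
    if v: "v \<in> carrier_vec m" for v
  proof -
    have XA: "mat_adjoint X * A \<in> carrier_mat m n" "A * X \<in> carrier_mat n m"
      "X *\<^sub>v v \<in> carrier_vec n" "A *\<^sub>v (X *\<^sub>v v) \<in> carrier_vec n" using A X v by auto
    have "(mat_adjoint X * A * X) *\<^sub>v v = mat_adjoint X *\<^sub>v (A *\<^sub>v (X *\<^sub>v v))"
      using assoc_mult_mat_vec[OF XA(1) X v] assoc_mult_mat_vec[OF adjoint_carrier[OF X] A XA(3)] by simp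
    then show ?thesis
      using adjoint_mult_vec[OF adjoint_carrier[OF X] XA(4) v] by simp
  qed
  moreover have "mat_adjoint (mat_adjoint X * A * X) = mat_adjoint X * A * X"
  proof -
    have "mat_adjoint (mat_adjoint X * A * X) = mat_adjoint X * mat_adjoint (mat_adjoint X * A)"
      using A X by (intro adjoint_mult) auto
    also have "mat_adjoint (mat_adjoint X * A) = mat_adjoint A * X"
      using adjoint_mult[OF adjoint_carrier[OF X] A] by simp
    also have "mat_adjoint A = A" using nn by (simp add: nonneg_hermitian_def)
    finally show ?thesis using assoc_mult_mat[OF adjoint_carrier[OF X] A X] by simp
  qed
  ultimately show ?thesis
    using nn nonneg_hermitian_iff[OF c] nonneg_hermitian_iff[OF A] X by (auto simp del: mult_carrier_mat)
qed

text \<open>If \<open>w = A v\<close> were nonzero, then the form at \<open>v - e w\<close> would be \<open>-2 e |w|\<^sup>2 + O(e\<^sup>2)\<close>, hence negative for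
  small \<open>e > 0\<close>.\<close>

lemma nonneg_hermitian_zero_form:
  assumes A: "A \<in> carrier_mat n n" and nn: "nonneg_hermitian A" and v: "v \<in> carrier_vec n"
    and z: "(A *\<^sub>v v) \<bullet>c v = 0"
  shows "A *\<^sub>v v = 0\<^sub>v n"
proof (rule ccontr)
  define w where "w = A *\<^sub>v v"
  assume "A *\<^sub>v v \<noteq> 0\<^sub>v n"
  have w: "w \<in> carrier_vec n" using A v by (simp add: w_def)
  have herm: "mat_adjoint A = A" using nn by (simp add: nonneg_hermitian_def)
  have Aw: "A *\<^sub>v w \<in> carrier_vec n" using A w by simp
  define N where "N = Re (w \<bullet>c w)"
  define M where "M = Re ((A *\<^sub>v w) \<bullet>c w)"
  have "w \<bullet>c w > 0" using \<open>A *\<^sub>v v \<noteq> 0\<^sub>v n\<close> w by (simp add: w_def)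
  then have N: "N > 0" by (simp add: N_def less_complex_def)
  have M: "M \<ge> 0" using nn A w by (simp add: M_def nonneg_hermitian_def)
  have form: "0 \<le> - 2 * e * N + e\<^sup>2 * M" for e :: real
  proof -
    define c where "c = - complex_of_real e"
    have cw: "c \<cdot>\<^sub>v w \<in> carrier_vec n" "c \<cdot>\<^sub>v (A *\<^sub>v w) \<in> carrier_vec n" using w Aw by auto
    have conjugate_add: "conjugate v + conjugate (c \<cdot>\<^sub>v w) \<in> carrier_vec n" using v cw by simp
    have "A *\<^sub>v (v + c \<cdot>\<^sub>v w) = w + c \<cdot>\<^sub>v (A *\<^sub>v w)"
      using mult_add_distrib_mat_vec[OF A v cw(1)] mult_mat_vec[OF A w, of c] by (simp add: w_def)
    moreover have "(w + c \<cdot>\<^sub>v (A *\<^sub>v w)) \<bullet>c (v + c \<cdot>\<^sub>v w) =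
       w \<bullet>c v + c * (w \<bullet>c w) + (c * ((A *\<^sub>v w) \<bullet>c v) + c * (c * ((A *\<^sub>v w) \<bullet>c w)))"
      using v w Aw cw
      unfolding conjugate_add_vec[OF v cw(1)] add_scalar_prod_distrib[OF w cw(2) conjugate_add]
      by (simp add: conjugate_smult_vec scalar_prod_add_distrib[of _ n] c_def algebra_simps)
    moreover have "w \<bullet>c v = 0" using z by (simp add: w_def)
    moreover have "(A *\<^sub>v w) \<bullet>c v = w \<bullet>c w"
      using adjoint_mult_vec[OF A w v] herm by (simp add: w_def)
    moreover have "0 \<le> Re ((A *\<^sub>v (v + c \<cdot>\<^sub>v w)) \<bullet>c (v + c \<cdot>\<^sub>v w))"
      using nn A v cw by (simp add: nonneg_hermitian_def)
    ultimately have "0 \<le> Re (c * (w \<bullet>c w) + (c * (w \<bullet>c w) + c * (c * ((A *\<^sub>v w) \<bullet>c w))))"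
      by (metis add_0)
    then show ?thesis by (simp add: c_def N_def M_def power2_eq_square algebra_simps)
  qed
  \<comment> \<open>Any \<open>e > 0\<close> with \<open>e M < 2 N\<close> contradicts \<open>form\<close>; \<open>M + 1\<close> avoids division by zero.\<close>
  define e where "e = N / (M + 1)"
  have e: "e > 0" "e * M < N" using N M by (simp_all add: e_def field_simps)
  have "0 \<le> e * (e * M - 2 * N)" using form[of e] by (simp add: power2_eq_square algebra_simps)
  then have "2 * N \<le> e * M" using e(1) by (simp add: zero_le_mult_iff)
  then show False using e(2) N by simp
qed

lemma nonneg_hermitian_block_diag:
  assumes A: "A \<in> carrier_mat n n" and D: "D \<in> carrier_mat m m"
  shows "nonneg_hermitian (four_block_mat A (0\<^sub>m n m) (0\<^sub>m m n) D) \<longleftrightarrow>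
    nonneg_hermitian A \<and> nonneg_hermitian D" (is "nonneg_hermitian ?M \<longleftrightarrow> _")
proof -
  have M: "?M \<in> carrier_mat (n + m) (n + m)" using A D by simp
  have form: "(?M *\<^sub>v (v @\<^sub>v w)) \<bullet>c (v @\<^sub>v w) = (A *\<^sub>v v) \<bullet>c v + (D *\<^sub>v w) \<bullet>c w"
    if v: "v \<in> carrier_vec n" and w: "w \<in> carrier_vec m" for v w
  proof -
    have "?M *\<^sub>v (v @\<^sub>v w) = (A *\<^sub>v v + 0\<^sub>m n m *\<^sub>v w) @\<^sub>v (0\<^sub>m m n *\<^sub>v v + D *\<^sub>v w)"
      using A D v w by (intro four_block_mat_mult_vec) auto
    also have "\<dots> = (A *\<^sub>v v) @\<^sub>v (D *\<^sub>v w)" proof -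
      have "0\<^sub>m n m *\<^sub>v w = 0\<^sub>v n" "0\<^sub>m m n *\<^sub>v v = 0\<^sub>v m"
        using v w by (auto intro!: eq_vecI simp: scalar_prod_def)
      then show ?thesis using A D v w by simp
    qed
    finally have 1: "?M *\<^sub>v (v @\<^sub>v w) = (A *\<^sub>v v) @\<^sub>v (D *\<^sub>v w)" .
    have 2: "conjugate (v @\<^sub>v w) = conjugate v @\<^sub>v conjugate w"
      by (rule eq_vecI) (use v w in auto)
    show ?thesis unfolding 1 2
      by (rule scalar_prod_append[of _ n _ m]) (use mult_mat_vec_carrier[OF A v] mult_mat_vec_carrier[OF D w] v w in auto)
  qed
  have adj: "mat_adjoint ?M = ?M \<longleftrightarrow> mat_adjoint A = A \<and> mat_adjoint D = D"
  proof
    assume h: "mat_adjoint ?M = ?M"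
    have e: "mat_adjoint ?M = four_block_mat (mat_adjoint A) (0\<^sub>m n m) (0\<^sub>m m n) (mat_adjoint D)"
      using A D by (subst adjoint_four_block[of _ n n _ m _ m]) auto
    have "mat_adjoint A $$ (i, j) = A $$ (i, j)" if "i < n" "j < n" for i j
      using arg_cong[OF h[unfolded e], of "\<lambda>X. X $$ (i, j)"] that A D by simp
    moreover have "mat_adjoint D $$ (i, j) = D $$ (i, j)" if "i < m" "j < m" for i j
      using arg_cong[OF h[unfolded e], of "\<lambda>X. X $$ (n + i, n + j)"] that A D by simp
    ultimately show "mat_adjoint A = A \<and> mat_adjoint D = D"
      using A D by (auto intro!: eq_matI)
  next
    assume "mat_adjoint A = A \<and> mat_adjoint D = D"
    then show "mat_adjoint ?M = ?M"
      using A D by (subst adjoint_four_block[of _ n n _ m _ m]) auto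
  qed
  have "(\<forall>v \<in> carrier_vec (n + m). 0 \<le> Re ((?M *\<^sub>v v) \<bullet>c v)) \<longleftrightarrow>
    (\<forall>v \<in> carrier_vec n. 0 \<le> Re ((A *\<^sub>v v) \<bullet>c v)) \<and> (\<forall>w \<in> carrier_vec m. 0 \<le> Re ((D *\<^sub>v w) \<bullet>c w))"
  proof (intro iffI conjI ballI)
    fix v :: "complex vec" assume h: "\<forall>v \<in> carrier_vec (n + m). 0 \<le> Re ((?M *\<^sub>v v) \<bullet>c v)" and v: "v \<in> carrier_vec n"
    show "0 \<le> Re ((A *\<^sub>v v) \<bullet>c v)"
      using h[rule_format, of "v @\<^sub>v 0\<^sub>v m"] form[OF v zero_carrier_vec[of m]] v D
      by (simp add: mult_mat_vec)
  next
    fix w :: "complex vec" assume h: "\<forall>v \<in> carrier_vec (n + m). 0 \<le> Re ((?M *\<^sub>v v) \<bullet>c v)" and w: "w \<in> carrier_vec m"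
    show "0 \<le> Re ((D *\<^sub>v w) \<bullet>c w)"
      using h[rule_format, of "0\<^sub>v n @\<^sub>v w"] form[OF zero_carrier_vec[of n] w] w A
      by (simp add: mult_mat_vec)
  next
    fix v :: "complex vec" assume h: "(\<forall>v \<in> carrier_vec n. 0 \<le> Re ((A *\<^sub>v v) \<bullet>c v)) \<and> (\<forall>w \<in> carrier_vec m. 0 \<le> Re ((D *\<^sub>v w) \<bullet>c w))"
      and v: "v \<in> carrier_vec (n + m)"
    have "v = vec_first v n @\<^sub>v vec_last v m" using v by simp
    then show "0 \<le> Re ((?M *\<^sub>v v) \<bullet>c v)"
      using form[of "vec_first v n" "vec_last v m"] h by simp
  qed
  then show ?thesis
    using nonneg_hermitian_iff[OF M] nonneg_hermitian_iff[OF A] nonneg_hermitian_iff[OF D] adj by blast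
qed

lemma block_unitriangular_inverse:
  assumes "Z \<in> carrier_mat n m"
  shows "four_block_mat (1\<^sub>m n) Z (0\<^sub>m m n) (1\<^sub>m m) * four_block_mat (1\<^sub>m n) (- Z) (0\<^sub>m m n) (1\<^sub>m m)
    = (1\<^sub>m (n + m) :: complex mat)"
    "four_block_mat (1\<^sub>m n) (- Z) (0\<^sub>m m n) (1\<^sub>m m) * four_block_mat (1\<^sub>m n) Z (0\<^sub>m m n) (1\<^sub>m m)
    = (1\<^sub>m (n + m) :: complex mat)"
proof -
  have *: "- (0\<^sub>m m m) = (0\<^sub>m m m :: complex mat)" by (rule eq_matI) auto
  show "four_block_mat (1\<^sub>m n) Z (0\<^sub>m m n) (1\<^sub>m m) * four_block_mat (1\<^sub>m n) (- Z) (0\<^sub>m m n) (1\<^sub>m m)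
      = (1\<^sub>m (n + m) :: complex mat)"
    using assms by (subst mult_four_block_mat[of _ n n _ m _ m _ _ n _ m]) (auto simp: *)
  show "four_block_mat (1\<^sub>m n) (- Z) (0\<^sub>m m n) (1\<^sub>m m) * four_block_mat (1\<^sub>m n) Z (0\<^sub>m m n) (1\<^sub>m m)
      = (1\<^sub>m (n + m) :: complex mat)"
    using assms by (subst mult_four_block_mat[of _ n n _ m _ m _ _ n _ m])
      (auto simp: * comm_add_mat[of Z n m "- Z"])
qed

text \<open>Block elimination: the column \<open>Z\<close> solving \<open>A Z = B\<close> takes the role of \<open>inverse A * B\<close>, so that \<open>A\<close> may be
  singular.\<close>

lemma block_ldl:
  assumes A: "A \<in> carrier_mat n n" "mat_adjoint A = A" and Z: "Z \<in> carrier_mat n m" "A * Z = B"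
    and C: "C \<in> carrier_mat m m"
  defines "Y \<equiv> four_block_mat (1\<^sub>m n) Z (0\<^sub>m m n) (1\<^sub>m m)"
  shows "four_block_mat A B (mat_adjoint B) C =
    mat_adjoint Y * four_block_mat A (0\<^sub>m n m) (0\<^sub>m m n) (C - mat_adjoint B * Z) * (Y :: complex mat)"
proof -
  define L where "L = C - mat_adjoint B * Z"
  have B: "B \<in> carrier_mat n m" using A Z by auto
  have L: "L \<in> carrier_mat m m" using B C Z(1) by (auto simp: L_def)
  have Bs: "mat_adjoint Z * A = mat_adjoint B"
    using adjoint_mult[OF A(1) Z(1)] A(2) Z(2) by simp
  have "mat_adjoint Y = four_block_mat (1\<^sub>m n) (0\<^sub>m n m) (mat_adjoint Z) (1\<^sub>m m)"
    unfolding Y_def using Z by (subst adjoint_four_block[of _ n n _ m _ m]) auto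
  moreover have "four_block_mat (1\<^sub>m n) (0\<^sub>m n m) (mat_adjoint Z) (1\<^sub>m m) *
      four_block_mat A (0\<^sub>m n m) (0\<^sub>m m n) L = four_block_mat A (0\<^sub>m n m) (mat_adjoint B) L"
    using A Z L Bs B by (subst mult_four_block_mat[of _ n n _ m _ m _ _ n _ m]) auto
  moreover have "four_block_mat A (0\<^sub>m n m) (mat_adjoint B) L * Y = four_block_mat A B (mat_adjoint B) C"
  proof -
    have "mat_adjoint B * Z + L = C"
      using B C Z(1) by (auto simp: L_def intro!: eq_matI)
    then show ?thesis unfolding Y_def
      using A Z L Bs B by (subst mult_four_block_mat[of _ n n _ m _ m _ _ n _ m]) auto
  qed
  ultimately show ?thesis by (simp add: L_def)
qed

text \<open>This is Albert's criterion for block matrices. The matrix is congruent to the block diagonal of \<open>A\<close>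
  and the Schur complement, and the congruence is invertible.\<close>

lemma nonneg_hermitian_block_iff:
  assumes A: "A \<in> carrier_mat n n" "mat_adjoint A = A" and Z: "Z \<in> carrier_mat n m" "A * Z = B"
    and C: "C \<in> carrier_mat m m"
  shows "nonneg_hermitian (four_block_mat A B (mat_adjoint B) C) \<longleftrightarrow>
    nonneg_hermitian A \<and> nonneg_hermitian (C - mat_adjoint B * Z)"
proof -
  define Y where "Y = four_block_mat (1\<^sub>m n) Z (0\<^sub>m m n) (1\<^sub>m m)"
  define Y' where "Y' = four_block_mat (1\<^sub>m n) (- Z) (0\<^sub>m m n) (1\<^sub>m m)"
  define L where "L = C - mat_adjoint B * Z"
  define D where "D = four_block_mat A (0\<^sub>m n m) (0\<^sub>m m n) L"
  define M where "M = four_block_mat A B (mat_adjoint B) C"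
  have B: "B \<in> carrier_mat n m" using A Z by auto
  have L: "L \<in> carrier_mat m m" using B C Z(1) by (auto simp: L_def)
  have c: "Y \<in> carrier_mat (n+m) (n+m)" "Y' \<in> carrier_mat (n+m) (n+m)" "D \<in> carrier_mat (n+m) (n+m)"
    "M \<in> carrier_mat (n+m) (n+m)"
    using A L Z C by (auto simp: Y_def Y'_def D_def M_def)
  note assoc = assoc_mult_mat[of _ "n+m" "n+m" _ "n+m" _ "n+m"]
  have M: "M = mat_adjoint Y * D * Y"
    using block_ldl[OF A Z C] by (simp add: M_def D_def Y_def L_def)
  have YY: "Y * Y' = 1\<^sub>m (n+m)" using block_unitriangular_inverse(1)[OF Z(1)] by (simp add: Y_def Y'_def)
  then have YY': "mat_adjoint Y' * mat_adjoint Y = 1\<^sub>m (n+m)" using adjoint_mult[OF c(1,2)] by simp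
  have "mat_adjoint Y' * M * Y' = (mat_adjoint Y' * mat_adjoint Y) * D * (Y * Y')"
  proof -
    have c': "mat_adjoint Y \<in> carrier_mat (n+m) (n+m)" "mat_adjoint Y' \<in> carrier_mat (n+m) (n+m)"
      "D * Y \<in> carrier_mat (n+m) (n+m)" "Y * Y' \<in> carrier_mat (n+m) (n+m)"
      "mat_adjoint Y * (D * Y) \<in> carrier_mat (n+m) (n+m)" "mat_adjoint Y * D \<in> carrier_mat (n+m) (n+m)"
      "D * (Y * Y') \<in> carrier_mat (n+m) (n+m)"
      using c by (auto intro!: mult_carrier_mat[of _ "n+m" "n+m"])
    have "mat_adjoint Y' * M * Y' = mat_adjoint Y' * (mat_adjoint Y * (D * (Y * Y')))"
      unfolding M using c c' by (simp add: assoc)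
    then show ?thesis using c c' by (simp add: assoc)
  qed
  also have "\<dots> = D" using c by (simp add: YY YY')
  finally have D: "D = mat_adjoint Y' * M * Y'" by simp
  have "nonneg_hermitian M \<longleftrightarrow> nonneg_hermitian D"
    using nonneg_hermitian_congruence[OF c(3) c(1)] nonneg_hermitian_congruence[OF c(4) c(2)]
    unfolding M[symmetric] D[symmetric] by blast
  then show ?thesis using nonneg_hermitian_block_diag[OF A(1) L] by (simp add: M_def D_def L_def)
qed

text \<open>A kernel vector \<open>v\<close> of the corner \<open>A\<close>, extended by zeros, is isotropic for the whole matrix and is
  therefore annihilated by it; this gives the last claim.\<close>

lemma nonneg_hermitian_block_corner:
  assumes A: "A \<in> carrier_mat n n" and B: "B \<in> carrier_mat n m" and C: "C \<in> carrier_mat m m"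
    and M: "nonneg_hermitian (four_block_mat A B (mat_adjoint B) C)" (is "nonneg_hermitian ?M")
  shows "nonneg_hermitian A" and "mat_adjoint C = C"
    and "v \<in> carrier_vec n \<Longrightarrow> A *\<^sub>v v = 0\<^sub>v n \<Longrightarrow> mat_adjoint B *\<^sub>v v = 0\<^sub>v m"
proof -
  have Mc: "?M \<in> carrier_mat (n + m) (n + m)" using A C by simp
  have herm: "mat_adjoint ?M = ?M" using M by (simp add: nonneg_hermitian_def)
  have e: "mat_adjoint ?M = four_block_mat (mat_adjoint A) B (mat_adjoint B) (mat_adjoint C)"
    using A B C by (subst adjoint_four_block[of _ n n _ m _ m]) auto
  have Ah: "mat_adjoint A = A"
  proof (rule eq_matI)
    fix i j assume "i < dim_row A" "j < dim_col A"
    then show "mat_adjoint A $$ (i, j) = A $$ (i, j)"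
      using arg_cong[OF herm[unfolded e], of "\<lambda>X. X $$ (i, j)"] A C by simp
  qed (use A in auto)
  show "mat_adjoint C = C"
  proof (rule eq_matI)
    fix i j assume "i < dim_row C" "j < dim_col C"
    then show "mat_adjoint C $$ (i, j) = C $$ (i, j)"
      using arg_cong[OF herm[unfolded e], of "\<lambda>X. X $$ (n + i, n + j)"] A C by simp
  qed (use C in auto)
  have mul: "?M *\<^sub>v (v @\<^sub>v 0\<^sub>v m) = (A *\<^sub>v v) @\<^sub>v (mat_adjoint B *\<^sub>v v)" if v: "v \<in> carrier_vec n" for v
  proof -
    have "?M *\<^sub>v (v @\<^sub>v 0\<^sub>v m) = (A *\<^sub>v v + B *\<^sub>v 0\<^sub>v m) @\<^sub>v (mat_adjoint B *\<^sub>v v + C *\<^sub>v 0\<^sub>v m)"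
      using A B C v by (intro four_block_mat_mult_vec) auto
    moreover have "B *\<^sub>v 0\<^sub>v m = 0\<^sub>v n" "C *\<^sub>v 0\<^sub>v m = 0\<^sub>v m" using B C by (auto intro!: eq_vecI)
    ultimately show ?thesis
      using A B v right_zero_vec[of "A *\<^sub>v v" n] right_zero_vec[OF mult_mat_vec_carrier[OF adjoint_carrier[OF B] v]]
      by (simp del: right_zero_vec)
  qed
  have form: "(?M *\<^sub>v (v @\<^sub>v 0\<^sub>v m)) \<bullet>c (v @\<^sub>v 0\<^sub>v m) = (A *\<^sub>v v) \<bullet>c v" if v: "v \<in> carrier_vec n" for v
  proof -
    have 2: "conjugate (v @\<^sub>v 0\<^sub>v m) = conjugate v @\<^sub>v 0\<^sub>v m"
      by (rule eq_vecI) (use v in auto)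
    have "((A *\<^sub>v v) @\<^sub>v (mat_adjoint B *\<^sub>v v)) \<bullet> (conjugate v @\<^sub>v 0\<^sub>v m) =
      (A *\<^sub>v v) \<bullet>c v + (mat_adjoint B *\<^sub>v v) \<bullet> 0\<^sub>v m"
      by (rule scalar_prod_append[of _ n _ m])
        (use mult_mat_vec_carrier[OF A v] mult_mat_vec_carrier[OF adjoint_carrier[OF B] v] v in auto)
    then show ?thesis unfolding mul[OF v] 2
      using scalar_prod_right_zero[OF mult_mat_vec_carrier[OF adjoint_carrier[OF B] v]] by simp
  qed
  show "nonneg_hermitian A"
    unfolding nonneg_hermitian_iff[OF A]
  proof (intro conjI ballI Ah)
    fix v :: "complex vec" assume v: "v \<in> carrier_vec n"
    then have "v @\<^sub>v 0\<^sub>v m \<in> carrier_vec (n + m)" by simp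
    then show "0 \<le> Re ((A *\<^sub>v v) \<bullet>c v)"
      using M form[OF v] unfolding nonneg_hermitian_iff[OF Mc] by metis
  qed
  assume v: "v \<in> carrier_vec n" and z: "A *\<^sub>v v = 0\<^sub>v n"
  have vm: "v @\<^sub>v 0\<^sub>v m \<in> carrier_vec (n + m)" using v by simp
  have "?M *\<^sub>v (v @\<^sub>v 0\<^sub>v m) = 0\<^sub>v (n + m)"
    using form[OF v] v z by (intro nonneg_hermitian_zero_form[OF Mc M vm]) simp
  then have z2: "(A *\<^sub>v v) @\<^sub>v (mat_adjoint B *\<^sub>v v) = 0\<^sub>v (n + m)" using mul[OF v] by simp
  show "mat_adjoint B *\<^sub>v v = 0\<^sub>v m"
  proof (rule eq_vecI)
    fix i assume "i < dim_vec (0\<^sub>v m :: complex vec)"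
    then show "(mat_adjoint B *\<^sub>v v) $ i = 0\<^sub>v m $ i"
      using arg_cong[OF z2, of "\<lambda>x. x $ (n + i)"] A B v by simp
  qed (use B in auto)
qed

text \<open>The columns of \<open>1 - G A\<close> lie in the kernel of \<open>A\<close>, hence in the kernel of the adjoint of \<open>B\<close>.
  Consequently \<open>A Z = B\<close> is solvable, by \<open>Z = G B\<close>.\<close>

lemma nonneg_hermitian_block_range:
  assumes A: "A \<in> carrier_mat n n" and B: "B \<in> carrier_mat n m" and C: "C \<in> carrier_mat m m"
    and M: "nonneg_hermitian (four_block_mat A B (mat_adjoint B) C)"
    and G: "G \<in> carrier_mat n n" "mat_adjoint G = G" "A * G * A = A"
  shows "A * (G * B) = B"
proof -
  note corner = nonneg_hermitian_block_corner[OF A B C M]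
  have Ah: "mat_adjoint A = A" using corner(1) by (simp add: nonneg_hermitian_def)
  define K where "K = 1\<^sub>m n - G * A"
  have K: "K \<in> carrier_mat n n" using A G by (auto simp: K_def)
  have "A * K = A * 1\<^sub>m n - A * (G * A)"
    unfolding K_def using A G by (intro mult_minus_distrib_mat) auto
  then have AK: "A * K = 0\<^sub>m n n"
    using assoc_mult_mat[OF A G(1) A] G(3) A by (simp add: minus_r_inv_mat)
  have BK: "mat_adjoint B * K = 0\<^sub>m m n"
  proof (rule mat_col_eqI)
    fix j assume "j < dim_col (0\<^sub>m m n :: complex mat)"
    then have j: "j < n" by simp
    have "A *\<^sub>v col K j = col (A * K) j" by (rule col_mult2[OF A K j, symmetric])
    also have "\<dots> = 0\<^sub>v n" unfolding AK using j by simp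
    finally have "A *\<^sub>v col K j = 0\<^sub>v n" .
    then have "mat_adjoint B *\<^sub>v col K j = 0\<^sub>v m" using corner(3) K j by simp
    then show "col (mat_adjoint B * K) j = col (0\<^sub>m m n) j"
      using j B K by (simp add: col_mult2[OF adjoint_carrier[OF B] K])
  qed (use B K in auto)
  have GA: "G * A \<in> carrier_mat n n" and Bs: "mat_adjoint B \<in> carrier_mat m n"
    and BGA: "mat_adjoint B * (G * A) \<in> carrier_mat m n"
    using A B G(1) by (auto intro!: mult_carrier_mat[of _ m n])
  have "mat_adjoint B - mat_adjoint B * (G * A) = 0\<^sub>m m n"
    using BK mult_minus_distrib_mat[OF Bs one_carrier_mat[of n] GA] right_mult_one_mat[OF Bs]
    by (simp add: K_def)
  then have "mat_adjoint B = mat_adjoint B * (G * A)"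
    by (rule minus_zero_imp_eq_mat[OF Bs BGA])
  then have "mat_adjoint (mat_adjoint B * (G * A)) = B" by (metis adjoint_adjoint)
  moreover have "mat_adjoint (mat_adjoint B * (G * A)) = mat_adjoint (G * A) * B"
    using adjoint_mult[OF adjoint_carrier[OF B], of "G * A" n] A G by simp
  moreover have "mat_adjoint (G * A) = A * G"
    using adjoint_mult[OF G(1) A] Ah G by simp
  ultimately have "A * G * B = B" by metis
  then show ?thesis using assoc_mult_mat[OF A G(1) B] by metis
qed

text \<open>Induction on the size: block elimination of the last row and column reduces the matrix to a smaller
  one and a scalar, and inner inverses are carried along congruences.\<close>

lemma ex_hermitian_inner_inverse:
  assumes "A \<in> carrier_mat n n" "nonneg_hermitian A"
  shows "\<exists>G \<in> carrier_mat n n. mat_adjoint G = G \<and> A * G * A = A"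
  using assms
proof (induction n arbitrary: A)
  case 0
  have "mat_adjoint A = A" "A * A * A = A" using 0(1) by (auto intro!: eq_matI)
  then show ?case using 0(1) by blast
next
  case (Suc n)
  define A' where "A' = mat n n (\<lambda>(i, j). A $$ (i, j))"
  define B where "B = mat n 1 (\<lambda>(i, j). A $$ (i, n))"
  define C where "C = mat 1 1 (\<lambda>(i, j). A $$ (n, n))"
  have c: "A' \<in> carrier_mat n n" "B \<in> carrier_mat n 1" "C \<in> carrier_mat 1 1"
    by (auto simp: A'_def B_def C_def)
  have Ah: "mat_adjoint A = A" using Suc.prems by (simp add: nonneg_hermitian_def)
  have A: "A = four_block_mat A' B (mat_adjoint B) C"
  proof (rule eq_matI)
    fix i j assume ij: "i < dim_row (four_block_mat A' B (mat_adjoint B) C)"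
      "j < dim_col (four_block_mat A' B (mat_adjoint B) C)"
    have "A $$ (n, j) = cnj (A $$ (j, n))" if "j < n"
      using arg_cong[OF Ah, of "\<lambda>X. X $$ (n, j)"] Suc.prems(1) that by simp
    moreover have "i < n \<or> i = n" "j < n \<or> j = n" using ij c by auto
    ultimately show "A $$ (i, j) = four_block_mat A' B (mat_adjoint B) C $$ (i, j)"
      by (elim disjE) (auto simp: A'_def B_def C_def)
  qed (use Suc.prems c in auto)
  note nn = Suc.prems(2)[unfolded A]
  have A'nn: "nonneg_hermitian A'" by (rule nonneg_hermitian_block_corner(1)[OF c nn])
  then have A'h: "mat_adjoint A' = A'" by (simp add: nonneg_hermitian_def)
  obtain G where G: "G \<in> carrier_mat n n" "mat_adjoint G = G" "A' * G * A' = A'"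
    using Suc.IH[OF c(1) A'nn] by blast
  define Z where "Z = G * B"
  have Z: "Z \<in> carrier_mat n 1" "A' * Z = B"
    using nonneg_hermitian_block_range[OF c nn G] G c by (auto simp: Z_def)
  define L where "L = C - mat_adjoint B * Z"
  have L: "L \<in> carrier_mat 1 1" using c Z(1) by (auto simp: L_def)
  have Lh: "mat_adjoint L = L"
    using nonneg_hermitian_block_iff[OF c(1) A'h Z c(3)] nn by (simp add: L_def nonneg_hermitian_def)
  \<comment> \<open>For \<open>L = 0\<close> the convention \<open>inverse 0 = 0\<close> gives the right scalar inner inverse.\<close>
  define l where "l = mat 1 1 (\<lambda>_. inverse (L $$ (0, 0)))"
  have l: "l \<in> carrier_mat 1 1" "mat_adjoint l = l" "L * l * L = L"
  proof -
    show l: "l \<in> carrier_mat 1 1" by (simp add: l_def)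
    have "cnj (L $$ (0, 0)) = L $$ (0, 0)"
      using arg_cong[OF Lh, of "\<lambda>X. X $$ (0, 0)"] L by simp
    then show "mat_adjoint l = l" by (intro eq_matI) (auto simp: l_def)
    show "L * l * L = L"
      using L l right_inverse[of "L $$ (0, 0)"]
      by (intro eq_matI) (auto simp: scalar_prod_def l_def simp del: right_inverse)
  qed
  define N where "N = n + (1 :: nat)"
  define Y where "Y = four_block_mat (1\<^sub>m n) Z (0\<^sub>m 1 n) (1\<^sub>m 1)"
  define Y' where "Y' = four_block_mat (1\<^sub>m n) (- Z) (0\<^sub>m 1 n) (1\<^sub>m 1)"
  define D where "D = four_block_mat A' (0\<^sub>m n 1) (0\<^sub>m 1 n) L"
  define D' where "D' = four_block_mat G (0\<^sub>m n 1) (0\<^sub>m 1 n) l"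
  have cc: "Y \<in> carrier_mat N N" "Y' \<in> carrier_mat N N" "D \<in> carrier_mat N N" "D' \<in> carrier_mat N N"
    using c G(1) L l(1) by (auto simp: Y_def Y'_def D_def D'_def N_def)
  have ac: "mat_adjoint Y \<in> carrier_mat N N" "mat_adjoint Y' \<in> carrier_mat N N"
    using cc by auto
  have AM: "A = mat_adjoint Y * D * Y"
    using block_ldl[OF c(1) A'h Z c(3)] A by (simp add: D_def Y_def L_def)
  have YY: "Y * Y' = 1\<^sub>m N"
    using block_unitriangular_inverse(1)[OF Z(1)] by (simp add: Y_def Y'_def N_def)
  then have YY': "mat_adjoint Y' * mat_adjoint Y = 1\<^sub>m N" using adjoint_mult[OF cc(1,2)] by simp
  have DD: "D * D' * D = D"
    unfolding D_def D'_def using c G L l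
    by (simp add: mult_four_block_mat[of _ n n _ 1 _ 1 _ _ n _ 1] mult_carrier_mat[of _ n n] mult_carrier_mat[of _ 1 1])
  have D'h: "mat_adjoint D' = D'"
    unfolding D'_def using G l by (simp add: adjoint_four_block[of _ n n _ 1 _ 1])
  define X where "X = Y' * D' * mat_adjoint Y'"
  note assoc = assoc_mult_mat[of _ N N _ N _ N] mult_carrier_mat[of _ N N _ N]
  have "A * X * A = mat_adjoint Y * D * (Y * Y') * D' * (mat_adjoint Y' * mat_adjoint Y) * D * Y"
    unfolding AM X_def using cc ac by (simp add: assoc)
  also have "\<dots> = mat_adjoint Y * (D * D' * D) * Y"
    unfolding YY YY' using cc ac by (simp add: assoc)
  also have "\<dots> = A" by (simp add: AM DD)
  finally have "A * X * A = A" .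
  moreover have "mat_adjoint X = X"
  proof -
    have "mat_adjoint X = mat_adjoint (mat_adjoint Y') * mat_adjoint (Y' * D')"
      unfolding X_def using cc ac by (intro adjoint_mult) (auto intro: mult_carrier_mat)
    also have "mat_adjoint (Y' * D') = D' * mat_adjoint Y'"
      using adjoint_mult[OF cc(2,4)] D'h by simp
    finally show ?thesis unfolding X_def using cc ac by (simp add: assoc)
  qed
  moreover have "X \<in> carrier_mat (Suc n) (Suc n)"
    using cc ac by (auto simp: X_def N_def intro!: mult_carrier_mat)
  ultimately show ?case by blast
qed

lemma adjoint_mult_self_eq_zero:
  assumes X: "X \<in> carrier_mat n m" and z: "mat_adjoint X * X = (0\<^sub>m m m :: complex mat)"
  shows "X = 0\<^sub>m n m"
proof (rule mat_col_eqI)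
  fix j assume "j < dim_col (0\<^sub>m n m :: complex mat)"
  then have j: "j < m" by simp
  have "row (mat_adjoint X) j = conjugate (col X j)"
    using X j by (intro eq_vecI) auto
  then have "conjugate (col X j) \<bullet> col X j = 0"
    using arg_cong[OF z, of "\<lambda>Y. Y $$ (j, j)"] X j by simp
  then have "col X j \<bullet>c col X j = 0"
    using X j conjugate_vec_sprod_comm[of "col X j" n "col X j"] by simp
  then have "col X j = 0\<^sub>v n" using X j by (subst (asm) conjugate_square_eq_0_vec[of _ n]) auto
  then show "col X j = col (0\<^sub>m n m) j" using j by simp
qed (use X in auto)

lemma is_moore_penrose_unique:
  assumes A: "A \<in> carrier_mat n m" and X: "is_moore_penrose A X" and Y: "is_moore_penrose A Y"
  shows "X = Y"
proof -
  have c: "X \<in> carrier_mat m n" "Y \<in> carrier_mat m n" using A X Y by (auto simp: is_moore_penrose_def)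
  have ac: "A * X \<in> carrier_mat n n" "A * Y \<in> carrier_mat n n"
    "X * A \<in> carrier_mat m m" "Y * A \<in> carrier_mat m m" using A c by auto
  have Xp: "A * X * A = A" "mat_adjoint (A * X) = A * X" "mat_adjoint (X * A) = X * A"
    using X by (auto simp: is_moore_penrose_def)
  have AX: "A * X = A * Y"
  proof -
    have "A * X = A * Y * (A * X)"
      using Y assoc_mult_mat[OF ac(2) A c(1)] by (simp add: is_moore_penrose_def)
    then have "mat_adjoint (A * X) = mat_adjoint (A * X) * mat_adjoint (A * Y)"
      using adjoint_mult[OF ac(2,1)] by simp
    also have "\<dots> = A * X * A * Y"
      using X Y assoc_mult_mat[OF ac(1) A c(2)] by (simp add: is_moore_penrose_def)
    finally show ?thesis unfolding Xp .
  qed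
  have XA: "X * A = Y * A"
  proof -
    have "X * A = X * A * (Y * A)"
      using Y assoc_mult_mat[OF c(1) A, of "Y * A" m] assoc_mult_mat[OF A c(2) A] ac A by (simp add: is_moore_penrose_def)
    then have "mat_adjoint (X * A) = mat_adjoint (Y * A) * mat_adjoint (X * A)"
      using adjoint_mult[OF ac(3,4)] by simp
    also have "\<dots> = Y * (A * X * A)"
      using X Y assoc_mult_mat[OF c(2) A ac(3)] assoc_mult_mat[OF A c(1) A] by (simp add: is_moore_penrose_def)
    finally show ?thesis unfolding Xp .
  qed
  have "X = X * A * X" using X by (simp add: is_moore_penrose_def)
  also have "\<dots> = Y * (A * X)" using XA assoc_mult_mat[OF c(2) A c(1)] by simp
  also have "\<dots> = Y" using AX assoc_mult_mat[OF c(2) A c(2)] Y by (simp add: is_moore_penrose_def)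
  finally show ?thesis .
qed

text \<open>If \<open>J\<close> is a Hermitian inner inverse of \<open>A\<^sup>3\<close>, then \<open>A J A\<close> is the Moore--Penrose inverse of \<open>A\<close>: factors
  of \<open>A\<close> can be cancelled from \<open>A\<^sup>3 J A\<^sup>3 = A\<^sup>3\<close> because a Hermitian matrix and its square have the same
  kernel.\<close>

lemma moore_penrose_nonneg_hermitian:
  assumes A: "A \<in> carrier_mat n n" and nn: "nonneg_hermitian A"
  shows "pinv A \<in> carrier_mat n n" "mat_adjoint (pinv A) = pinv A"
    "A * pinv A = pinv A * A" "A * pinv A * A = A" "pinv A * A * pinv A = pinv A"
proof -
  have Ah: "mat_adjoint A = A" using nn by (simp add: nonneg_hermitian_def)
  note assoc = assoc_mult_mat[of _ n n _ n _ n] mult_carrier_mat[of _ n n _ n]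
  have adj: "mat_adjoint (X * Y) = mat_adjoint Y * mat_adjoint X"
    if "X \<in> carrier_mat n n" "Y \<in> carrier_mat n n" for X Y :: "complex mat"
    using adjoint_mult[OF that] .
  have AA: "A * A \<in> carrier_mat n n" "A * A * A \<in> carrier_mat n n" using A by (auto intro!: assoc)
  have "nonneg_hermitian (A * A * A)"
    using nonneg_hermitian_congruence[OF A A nn] by (simp add: Ah)
  then obtain J where J: "J \<in> carrier_mat n n" and Jh: "mat_adjoint J = J"
    and "(A * A * A) * J * (A * A * A) = A * A * A"
    using ex_hermitian_inner_inverse[OF AA(2)] by blast
  then have J3: "A * (A * (A * (J * (A * (A * A))))) = A * (A * A)"
    using A by (simp add: assoc)
  have cancel: "A * Y = 0\<^sub>m n n" if Y: "Y \<in> carrier_mat n n" and z: "A * (A * Y) = 0\<^sub>m n n" for Y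
  proof (rule adjoint_mult_self_eq_zero)
    have "mat_adjoint (A * Y) * (A * Y) = mat_adjoint Y * (A * (A * Y))"
      using A Y adjoint_carrier[OF Y] by (simp add: adj Ah assoc)
    then show "mat_adjoint (A * Y) * (A * Y) = 0\<^sub>m n n"
      using right_mult_zero_mat[OF adjoint_carrier[OF Y]] by (simp add: z)
  qed (use A Y in \<open>auto intro: assoc\<close>)
  have AJ: "A * (J * (A * (A * A))) = A"
  proof -
    define T where "T = J * (A * (A * A))"
    have T: "T \<in> carrier_mat n n" using A J by (auto simp: T_def intro!: assoc)
    have d: "A * (Y - Y') = A * Y - A * Y'" if "Y \<in> carrier_mat n n" "Y' \<in> carrier_mat n n" for Y Y'
      using mult_minus_distrib_mat[OF A that] .
    have Y: "T - 1\<^sub>m n \<in> carrier_mat n n" using T by auto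
    have AT: "A * T \<in> carrier_mat n n" "A * (A * T) \<in> carrier_mat n n" "A * (A * A) \<in> carrier_mat n n"
      using A T by (auto intro!: assoc)
    have "A * (T - 1\<^sub>m n) = A * T - A"
      using d[OF T one_carrier_mat] A by simp
    then have "A * (A * (A * (T - 1\<^sub>m n))) = A * (A * (A * T)) - A * (A * A)"
      using d[OF AT(1) A] d[OF AT(2) AA(1)] by simp
    also have "\<dots> = 0\<^sub>m n n"
      using J3 minus_r_inv_mat[OF AT(3)] by (simp add: T_def)
    finally have "A * (A * (A * (T - 1\<^sub>m n))) = 0\<^sub>m n n" .
    then have "A * (A * (T - 1\<^sub>m n)) = 0\<^sub>m n n"
      by (rule cancel[OF mult_carrier_mat[OF A Y]])
    then have "A * (T - 1\<^sub>m n) = 0\<^sub>m n n"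
      by (rule cancel[OF Y])
    then have "A * T - A = 0\<^sub>m n n" unfolding \<open>A * (T - 1\<^sub>m n) = A * T - A\<close> .
    then show ?thesis
      unfolding T_def[symmetric] by (rule minus_zero_imp_eq_mat[OF AT(1) A])
  qed
  have JA: "A * (A * (A * (J * A))) = A"
    using arg_cong[OF AJ, of mat_adjoint] A J by (simp add: adj Ah Jh assoc)
  have AJA: "A * (A * (J * (A * A))) = A"
  proof -
    define T where "T = A * (A * (J * (A * A)))"
    define D where "D = T - A"
    have T: "T \<in> carrier_mat n n" using A J by (auto simp: T_def intro!: assoc)
    have D: "D \<in> carrier_mat n n" using A T by (auto simp: D_def)
    have Th: "mat_adjoint T = T" unfolding T_def using A J by (simp add: adj Ah Jh assoc)
    have Dh: "mat_adjoint D = D" unfolding D_def using adjoint_minus[OF T A] Th Ah by simp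
    have "T * A = A * A" unfolding T_def using A J AJ by (simp add: assoc)
    then have DA: "D * A = 0\<^sub>m n n"
      unfolding D_def using minus_mult_distrib_mat[OF T A A] AA by simp
    have "D * T = D * A * (A * (J * (A * A)))" unfolding T_def using D A J by (simp add: assoc)
    then have DT: "D * T = 0\<^sub>m n n" unfolding DA using A J by (simp add: assoc)
    have "D * D = D * T - D * A"
      using mult_minus_distrib_mat[OF D T A] by (simp add: D_def)
    then have "mat_adjoint D * D = 0\<^sub>m n n" using DT DA by (simp add: Dh minus_r_inv_mat[of _ n n])
    then have "D = 0\<^sub>m n n" by (rule adjoint_mult_self_eq_zero[OF D])
    then show ?thesis
      unfolding T_def[symmetric] D_def by (rule minus_zero_imp_eq_mat[OF T A])
  qed
  define X where "X = A * (J * A)"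
  have X: "X \<in> carrier_mat n n" using A J by (auto simp: X_def intro!: assoc)
  have Xh: "mat_adjoint X = X" unfolding X_def using A J by (simp add: adj Ah Jh assoc)
  \<comment> \<open>\<open>X A\<close> has the adjoint \<open>A X\<close>, so \<open>X A = (A X) (X A)\<close> makes it Hermitian and equal to \<open>A X\<close>.\<close>
  have F: "A * X * (X * A) = X * A"
  proof -
    have "A * X * (X * A) = A * (A * (J * (A * A))) * (J * (A * A))"
      unfolding X_def using A J by (simp add: assoc)
    then show ?thesis unfolding AJA X_def using A J by (simp add: assoc)
  qed
  have Fa: "mat_adjoint (X * A) = A * X" using A X by (simp add: adj Ah Xh)
  have comm: "A * X = X * A"
  proof -
    have "A * X = mat_adjoint (A * X * (X * A))" using F Fa by simp
    also have "\<dots> = A * X * (X * A)"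
      using A X by (simp add: adj[of "A * X" "X * A"] adj Ah Xh assoc)
    finally show ?thesis using F by simp
  qed
  have AXA: "A * X * A = A" using AJA A J by (simp add: X_def assoc)
  have XAX: "X * A * X = X"
  proof -
    have "X * A * X = A * (J * (A * (A * (A * (J * A)))))" unfolding X_def using A J by (simp add: assoc)
    then show ?thesis unfolding JA by (simp add: X_def)
  qed
  have "is_moore_penrose A X"
    using A X AXA XAX comm Fa by (simp add: is_moore_penrose_def)
  then have "pinv A = X"
    unfolding pinv_def by (intro the_equality) (use is_moore_penrose_unique[OF A] in blast)+
  then show "pinv A \<in> carrier_mat n n" "mat_adjoint (pinv A) = pinv A"
    "A * pinv A = pinv A * A" "A * pinv A * A = A" "pinv A * A * pinv A = pinv A"
    using X Xh comm AXA XAX by auto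
qed

section \<open>Block matrices and matrices over power series\<close>

lemma mult_entry:
  assumes "A \<in> carrier_mat n m" "B \<in> carrier_mat m l" "i < n" "j < l"
  shows "(A * B) $$ (i, j) = (\<Sum>k<m. A $$ (i, k) * B $$ (k, j))"
  using assms by (simp add: scalar_prod_def lessThan_atLeast0)

lemma msum_carrier [simp]: "msum q f I \<in> carrier_mat q q"
  by (simp add: msum_def)

lemma msum_index [simp]:
  "i < q \<Longrightarrow> j < q \<Longrightarrow> msum q f I $$ (i, j) = (\<Sum>r\<in>I. f r $$ (i, j))"
  "dim_row (msum q f I) = q" "dim_col (msum q f I) = q"
  by (simp_all add: msum_def)

lemma msum_eqI:
  assumes "\<And>r. r \<in> I \<Longrightarrow> f r = g r"
  shows "msum q f I = msum q g I"
  by (rule msum_cong) (use assms in auto)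

lemma msum_mult_left:
  assumes "M \<in> carrier_mat q q" "\<And>r. r \<in> I \<Longrightarrow> f r \<in> carrier_mat q q"
  shows "M * msum q f I = msum q (\<lambda>r. M * f r) I"
proof (rule eq_matI)
  fix i j assume "i < dim_row (msum q (\<lambda>r. M * f r) I)" "j < dim_col (msum q (\<lambda>r. M * f r) I)"
  then have ij: "i < q" "j < q" by auto
  have "(M * msum q f I) $$ (i, j) = (\<Sum>k<q. \<Sum>r\<in>I. M $$ (i, k) * f r $$ (k, j))"
    using assms ij by (simp add: scalar_prod_def sum_distrib_left lessThan_atLeast0)
  also have "\<dots> = (\<Sum>r\<in>I. \<Sum>k<q. M $$ (i, k) * f r $$ (k, j))" by (rule sum.swap)
  also have "\<dots> = msum q (\<lambda>r. M * f r) I $$ (i, j)"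
    using ij assms(1) by (auto simp: scalar_prod_def lessThan_atLeast0 dest!: assms(2) intro!: sum.cong)
  finally show "(M * msum q f I) $$ (i, j) = msum q (\<lambda>r. M * f r) I $$ (i, j)" .
qed (use assms in auto)

lemma msum_uminus:
  assumes "\<And>r. r \<in> I \<Longrightarrow> f r \<in> carrier_mat q q"
  shows "msum q (\<lambda>r. - f r) I = - msum q f I"
  by (rule eq_matI) (auto simp: sum_negf[symmetric] dest!: assms intro!: sum.cong)

lemma msum_zero: "(\<And>r. r \<in> I \<Longrightarrow> f r = 0\<^sub>m q q) \<Longrightarrow> msum q f I = 0\<^sub>m q q"
  by (rule eq_matI) auto

lemma msum_insert:
  assumes "finite I" "a \<notin> I" "f a \<in> carrier_mat q q"
  shows "msum q f (insert a I) = f a + msum q f I"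
  by (rule eq_matI) (use assms in auto)

lemma block_mat_carrier [simp]: "block_mat q a b F \<in> carrier_mat (a * q) (b * q)"
  by (simp add: block_mat_def)

lemma block_mat_dim [simp]: "dim_row (block_mat q a b F) = a * q" "dim_col (block_mat q a b F) = b * q"
  by (simp_all add: block_mat_def)

lemma block_mat_index:
  "i < a * q \<Longrightarrow> j < b * q \<Longrightarrow> block_mat q a b F $$ (i, j) = F (i div q) (j div q) $$ (i mod q, j mod q)"
  by (simp add: block_mat_def)

lemma block_index_less:
  fixes j a i q :: nat
  assumes "j < a" "i < q" shows "j * q + i < a * q"
proof -
  have "j * q + i < j * q + q" using assms by simp
  also have "\<dots> = (j + 1) * q" by simp
  also have "\<dots> \<le> a * q" using assms by (intro mult_right_mono) auto
  finally show ?thesis .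
qed

lemma block_mat_block:
  assumes "j < a" "k < b" "i < q" "l < q"
  shows "block_mat q a b F $$ (j * q + i, k * q + l) = F j k $$ (i, l)"
  using assms block_index_less[of j a i q] block_index_less[of k b l q]
  by (simp add: block_mat_index)

lemma block_mat_cong:
  assumes "\<And>j k. j < a \<Longrightarrow> k < b \<Longrightarrow> F j k = G j k"
  shows "block_mat q a b F = block_mat q a b G"
proof (rule eq_matI)
  fix i j assume "i < dim_row (block_mat q a b G)" "j < dim_col (block_mat q a b G)"
  then show "block_mat q a b F $$ (i, j) = block_mat q a b G $$ (i, j)"
    using assms[of "i div q" "j div q"] by (simp add: block_mat_index less_mult_imp_div_less)
qed auto

lemma block_mat_eq_iff:
  assumes "\<And>j k. j < a \<Longrightarrow> k < b \<Longrightarrow> F j k \<in> carrier_mat q q"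
    "\<And>j k. j < a \<Longrightarrow> k < b \<Longrightarrow> G j k \<in> carrier_mat q q"
  shows "block_mat q a b F = block_mat q a b G \<longleftrightarrow> (\<forall>j<a. \<forall>k<b. F j k = G j k)"
proof (intro iffI allI impI)
  fix j k assume eq: "block_mat q a b F = block_mat q a b G" and jk: "j < a" "k < b"
  show "F j k = G j k"
  proof (rule eq_matI)
    fix i l assume "i < dim_row (G j k)" "l < dim_col (G j k)"
    then have "i < q" "l < q" using assms(2)[OF jk] by auto
    then show "F j k $$ (i, l) = G j k $$ (i, l)"
      using block_mat_block[OF jk, of i q l] eq by metis
  qed (use assms(1)[OF jk] assms(2)[OF jk] in auto)
next
  assume "\<forall>j<a. \<forall>k<b. F j k = G j k"
  then show "block_mat q a b F = block_mat q a b G" by (intro block_mat_cong) auto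
qed

lemma block_mat_mult:
  assumes F: "\<And>j k. j < a \<Longrightarrow> k < b \<Longrightarrow> F j k \<in> carrier_mat q q"
    and G: "\<And>j k. j < b \<Longrightarrow> k < c \<Longrightarrow> G j k \<in> carrier_mat q q"
  shows "block_mat q a b F * block_mat q b c G =
    block_mat q a c (\<lambda>j l. msum q (\<lambda>k. F j k * G k l) {..<b})"
proof (rule eq_matI)
  fix i j assume "i < dim_row (block_mat q a c (\<lambda>j l. msum q (\<lambda>k. F j k * G k l) {..<b}))"
    "j < dim_col (block_mat q a c (\<lambda>j l. msum q (\<lambda>k. F j k * G k l) {..<b}))"
  then have ij: "i < a * q" "j < c * q" by auto
  have q: "q > 0" using ij by (cases q) auto
  have d: "i div q < a" "j div q < c" "i mod q < q" "j mod q < q"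
    using ij q by (auto simp: less_mult_imp_div_less)
  have "(block_mat q a b F * block_mat q b c G) $$ (i, j) =
      (\<Sum>r<b * q. block_mat q a b F $$ (i, r) * block_mat q b c G $$ (r, j))"
    using ij by (simp add: scalar_prod_def lessThan_atLeast0)
  also have "\<dots> = (\<Sum>k<b. \<Sum>r\<in>{k * q..<k * q + q}. block_mat q a b F $$ (i, r) * block_mat q b c G $$ (r, j))"
    by (rule sum.nat_group[symmetric])
  also have "\<dots> = (\<Sum>k<b. \<Sum>l<q. F (i div q) k $$ (i mod q, l) * G k (j div q) $$ (l, j mod q))"
  proof (rule sum.cong)
    fix k assume "k \<in> {..<b}"
    then have k: "k < b" by simp
    have "(\<Sum>r\<in>{k * q..<k * q + q}. block_mat q a b F $$ (i, r) * block_mat q b c G $$ (r, j)) =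
        (\<Sum>l<q. block_mat q a b F $$ (i, k * q + l) * block_mat q b c G $$ (k * q + l, j))"
      using sum.shift_bounds_nat_ivl[of "\<lambda>r. block_mat q a b F $$ (i, r) * block_mat q b c G $$ (r, j)" 0 "k * q" q]
      by (simp add: lessThan_atLeast0 add.commute)
    also have "\<dots> = (\<Sum>l<q. F (i div q) k $$ (i mod q, l) * G k (j div q) $$ (l, j mod q))"
      using k ij block_index_less[OF k] by (intro sum.cong) (auto simp: block_mat_index)
    finally show "(\<Sum>r\<in>{k * q..<k * q + q}. block_mat q a b F $$ (i, r) * block_mat q b c G $$ (r, j)) =
      (\<Sum>l<q. F (i div q) k $$ (i mod q, l) * G k (j div q) $$ (l, j mod q))" .
  qed simp
  also have "\<dots> = msum q (\<lambda>k. F (i div q) k * G k (j div q)) {..<b} $$ (i mod q, j mod q)"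
    using d by (simp add: mult_entry[OF F[OF d(1)] G[OF _ d(2)]])
  finally show "(block_mat q a b F * block_mat q b c G) $$ (i, j) =
      block_mat q a c (\<lambda>j l. msum q (\<lambda>k. F j k * G k l) {..<b}) $$ (i, j)"
    using ij by (simp add: block_mat_index)
qed auto

lemma block_mat_adjoint:
  assumes F: "\<And>j k. j < a \<Longrightarrow> k < b \<Longrightarrow> F j k \<in> carrier_mat q q"
  shows "mat_adjoint (block_mat q a b F) = block_mat q b a (\<lambda>j k. mat_adjoint (F k j))"
proof (rule eq_matI)
  fix i j assume "i < dim_row (block_mat q b a (\<lambda>j k. mat_adjoint (F k j)))"
    "j < dim_col (block_mat q b a (\<lambda>j k. mat_adjoint (F k j)))"
  then have ij: "i < b * q" "j < a * q" by auto
  then have q: "q > 0" by (cases q) auto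
  have "F (j div q) (i div q) \<in> carrier_mat q q"
    using ij by (intro F) (auto simp: less_mult_imp_div_less)
  then show "mat_adjoint (block_mat q a b F) $$ (i, j) = block_mat q b a (\<lambda>j k. mat_adjoint (F k j)) $$ (i, j)"
    using ij q by (simp add: block_mat_index)
qed auto

lemma block_mat_single:
  assumes "A \<in> carrier_mat q q" shows "block_mat q 1 1 (\<lambda>_ _. A) = A"
  by (rule eq_matI) (use assms in \<open>auto simp: block_mat_index\<close>)

lemma block_column_eq:
  assumes "Z \<in> carrier_mat (n * q) q"
  shows "Z = block_mat q n 1 (\<lambda>k _. mat q q (\<lambda>(i, j). Z $$ (k * q + i, j)))"
proof (rule eq_matI)
  fix i j assume ij: "i < dim_row (block_mat q n 1 (\<lambda>k _. mat q q (\<lambda>(i, j). Z $$ (k * q + i, j))))"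
    "j < dim_col (block_mat q n 1 (\<lambda>k _. mat q q (\<lambda>(i, j). Z $$ (k * q + i, j))))"
  then have "q > 0" by (cases q) auto
  then show "Z $$ (i, j) = block_mat q n 1 (\<lambda>k _. mat q q (\<lambda>(i, j). Z $$ (k * q + i, j))) $$ (i, j)"
    using ij by (simp add: block_mat_index)
qed (use assms in auto)

lemma block_mat_border:
  assumes "F n n \<in> carrier_mat q q"
  shows "block_mat q (n + 1) (n + 1) F =
    four_block_mat (block_mat q n n F) (block_mat q n 1 (\<lambda>j _. F j n))
      (block_mat q 1 n (\<lambda>_ k. F n k)) (F n n)" (is "?L = ?R")
proof (rule eq_matI)
  fix i j assume "i < dim_row ?R" "j < dim_col ?R"
  then have ij: "i < n * q + q" "j < n * q + q" using assms by auto
  then have q: "q > 0" by (cases q) auto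
  have last: "k div q = n \<and> k mod q = k - n * q" if "\<not> k < n * q" "k < n * q + q" for k
  proof -
    have "k = (k - n * q) + q * n" "k - n * q < q" using that by auto
    then show ?thesis using q by (metis div_mult_self2 mod_mult_self2 div_less mod_less add_0 add.commute less_not_refl)
  qed
  show "?L $$ (i, j) = ?R $$ (i, j)"
    using ij assms last[of i] last[of j] by (auto simp: block_mat_index)
qed (use assms in auto)

text \<open>Sequences of matrices are encoded as matrices over the commutative ring of power series. In this way
  the library's matrix algebra applies to convolutions of sequences, and powers of the indeterminate
  act as scalars.\<close>

definition gen_fun :: "nat \<Rightarrow> (nat \<Rightarrow> complex mat) \<Rightarrow> complex fps mat" where
  "gen_fun q s = mat q q (\<lambda>(i, j). Abs_fps (\<lambda>n. s n $$ (i, j)))"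

definition coef :: "complex fps mat \<Rightarrow> nat \<Rightarrow> complex mat" where
  "coef A n = map_mat (\<lambda>f. fps_nth f n) A"

lemma gen_fun_carrier [simp]: "gen_fun q s \<in> carrier_mat q q"
  by (simp add: gen_fun_def)

lemma coef_carrier [simp]: "A \<in> carrier_mat q q \<Longrightarrow> coef A n \<in> carrier_mat q q"
  by (simp add: coef_def)

lemma coef_index [simp]:
  "i < dim_row A \<Longrightarrow> j < dim_col A \<Longrightarrow> coef A n $$ (i, j) = fps_nth (A $$ (i, j)) n"
  "dim_row (coef A n) = dim_row A" "dim_col (coef A n) = dim_col A"
  by (auto simp: coef_def)

lemma coef_gen_fun [simp]: "s n \<in> carrier_mat q q \<Longrightarrow> coef (gen_fun q s) n = s n"
  by (rule eq_matI) (auto simp: gen_fun_def)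

lemma coef_eqI:
  assumes "A \<in> carrier_mat q q" "B \<in> carrier_mat q q" "\<And>n. coef A n = coef B n"
  shows "A = B"
proof (rule eq_matI)
  fix i j assume "i < dim_row B" "j < dim_col B"
  then show "A $$ (i, j) = B $$ (i, j)"
    using assms(1,2) arg_cong[OF assms(3), of "\<lambda>X. X $$ (i, j)"] by (auto intro!: fps_ext)
qed (use assms in auto)

lemma coef_add:
  "A \<in> carrier_mat q q \<Longrightarrow> B \<in> carrier_mat q q \<Longrightarrow> coef (A + B) n = coef A n + coef B n"
  by (rule eq_matI) auto

lemma coef_minus:
  "A \<in> carrier_mat q q \<Longrightarrow> B \<in> carrier_mat q q \<Longrightarrow> coef (A - B) n = coef A n - coef B n"
  by (rule eq_matI) auto

lemma coef_X_power_smult: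
  "A \<in> carrier_mat q q \<Longrightarrow>
    coef (fps_X ^ k \<cdot>\<^sub>m A) n = (if n < k then 0\<^sub>m q q else coef A (n - k))"
  by (rule eq_matI) (auto simp: fps_X_power_mult_nth)

lemma coef_X_smult:
  "A \<in> carrier_mat q q \<Longrightarrow>
    coef (fps_X \<cdot>\<^sub>m A) n = (if n = 0 then 0\<^sub>m q q else coef A (n - 1))"
  by (rule eq_matI) auto

lemma coef_mult:
  assumes A: "A \<in> carrier_mat q q" and B: "B \<in> carrier_mat q q"
  shows "coef (A * B) n = msum q (\<lambda>i. coef A (n - i) * coef B i) {..n}"
proof (rule eq_matI)
  fix i j assume "i < dim_row (msum q (\<lambda>i. coef A (n - i) * coef B i) {..n})"
    "j < dim_col (msum q (\<lambda>i. coef A (n - i) * coef B i) {..n})"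
  then have ij: "i < q" "j < q" by auto
  have conv: "fps_nth (f * g) n = (\<Sum>r\<le>n. fps_nth f (n - r) * fps_nth g r)" for f g :: "complex fps"
    by (subst mult.commute, subst fps_mult_nth) (simp add: atLeast0AtMost mult.commute)
  have "coef (A * B) n $$ (i, j) = (\<Sum>k<q. fps_nth (A $$ (i, k) * B $$ (k, j)) n)"
    using A B ij by (simp add: mult_entry[OF A B] fps_sum_nth del: index_mult_mat(1))
  also have "\<dots> = (\<Sum>k<q. \<Sum>r\<le>n. fps_nth (A $$ (i, k)) (n - r) * fps_nth (B $$ (k, j)) r)"
    by (simp add: conv)
  also have "\<dots> = (\<Sum>r\<le>n. \<Sum>k<q. fps_nth (A $$ (i, k)) (n - r) * fps_nth (B $$ (k, j)) r)"
    by (rule sum.swap)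
  also have "\<dots> = msum q (\<lambda>i. coef A (n - i) * coef B i) {..n} $$ (i, j)"
    using A B ij
    by (simp add: mult_entry[OF coef_carrier[OF A] coef_carrier[OF B]] del: index_mult_mat(1))
  finally show "coef (A * B) n $$ (i, j) = msum q (\<lambda>i. coef A (n - i) * coef B i) {..n} $$ (i, j)" .
qed (use A B in auto)

lemma zero_minus_mat: "A \<in> carrier_mat n m \<Longrightarrow> 0\<^sub>m n m - A = - (A :: complex mat)"
  by (rule eq_matI) auto

lemma add_minus_cancel_mat:
  "A \<in> carrier_mat n m \<Longrightarrow> B \<in> carrier_mat n m \<Longrightarrow> A + (B - A) = (B :: complex mat)"
  by (rule eq_matI) auto

definition gen_const :: "nat \<Rightarrow> complex mat \<Rightarrow> complex fps mat" where
  "gen_const q A = gen_fun q (\<lambda>n. if n = 0 then A else 0\<^sub>m q q)"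

lemma gen_const_carrier [simp]: "gen_const q A \<in> carrier_mat q q"
  by (simp add: gen_const_def)

lemma gen_fun_dim [simp]: "dim_row (gen_fun q s) = q" "dim_col (gen_fun q s) = q"
  by (simp_all add: gen_fun_def)

lemma gen_const_dim [simp]: "dim_row (gen_const q A) = q" "dim_col (gen_const q A) = q"
  by (simp_all add: gen_const_def)

lemma coef_gen_const: "A \<in> carrier_mat q q \<Longrightarrow> coef (gen_const q A) n = (if n = 0 then A else 0\<^sub>m q q)"
  by (auto simp: gen_const_def)

lemma coef_gen_const_mult:
  assumes A: "A \<in> carrier_mat q q" and B: "B \<in> carrier_mat q q"
  shows "coef (gen_const q A * B) n = A * coef B n"
proof -
  have "coef (gen_const q A * B) n = msum q (\<lambda>i. coef (gen_const q A) (n - i) * coef B i) {..n}"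
    by (rule coef_mult) (use B in auto)
  also have "{..n} = insert n {..<n}" by auto
  also have "msum q (\<lambda>i. coef (gen_const q A) (n - i) * coef B i) (insert n {..<n}) =
      coef (gen_const q A) (n - n) * coef B n + msum q (\<lambda>i. coef (gen_const q A) (n - i) * coef B i) {..<n}"
    using B by (intro msum_insert) (auto intro!: mult_carrier_mat[of _ q q])
  also have "msum q (\<lambda>i. coef (gen_const q A) (n - i) * coef B i) {..<n} = 0\<^sub>m q q"
    by (rule msum_zero) (use A in \<open>simp add: coef_gen_const left_mult_zero_mat[OF coef_carrier[OF B]]\<close>)
  finally show ?thesis
    using A right_add_zero_mat[OF mult_carrier_mat[OF A coef_carrier[OF B]]] by (simp add: coef_gen_const)
qed

lemma coef_mult_gen_const:
  assumes A: "A \<in> carrier_mat q q" and B: "B \<in> carrier_mat q q"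
  shows "coef (B * gen_const q A) n = coef B n * A"
proof -
  have "coef (B * gen_const q A) n = msum q (\<lambda>i. coef B (n - i) * coef (gen_const q A) i) {..n}"
    by (rule coef_mult) (use B in auto)
  also have "{..n} = insert 0 {1..n}" by auto
  also have "msum q (\<lambda>i. coef B (n - i) * coef (gen_const q A) i) (insert 0 {1..n}) =
      coef B (n - 0) * coef (gen_const q A) 0 + msum q (\<lambda>i. coef B (n - i) * coef (gen_const q A) i) {1..n}"
    using B by (intro msum_insert) (auto intro!: mult_carrier_mat[of _ q q])
  also have "msum q (\<lambda>i. coef B (n - i) * coef (gen_const q A) i) {1..n} = 0\<^sub>m q q"
    by (rule msum_zero) (use A in \<open>simp add: coef_gen_const right_mult_zero_mat[OF coef_carrier[OF B]]\<close>)
  finally show ?thesis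
    using A right_add_zero_mat[OF mult_carrier_mat[OF coef_carrier[OF B] A]] by (simp add: coef_gen_const)
qed

lemma gen_const_mult:
  assumes "A \<in> carrier_mat q q" "B \<in> carrier_mat q q"
  shows "gen_const q A * gen_const q B = gen_const q (A * B)"
proof (rule coef_eqI[where q = q])
  fix n show "coef (gen_const q A * gen_const q B) n = coef (gen_const q (A * B)) n"
    using assms mult_carrier_mat[OF assms] by (simp add: coef_gen_const_mult coef_gen_const)
qed (auto intro!: mult_carrier_mat[of _ q q])

lemma coef_X_poly_smult:
  assumes "A \<in> carrier_mat q q"
  shows "coef ((1 - fps_const c * fps_X) \<cdot>\<^sub>m A) n =
    (- c) \<cdot>\<^sub>m (if n = 0 then 0\<^sub>m q q else coef A (n - 1)) + coef A n"
  by (rule eq_matI) (use assms in \<open>auto simp: algebra_simps mult.assoc\<close>)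

lemma gen_fun_plus_transform:
  assumes "\<And>j. s j \<in> carrier_mat q q"
  shows "gen_fun q (plus_transform q \<alpha> s) = (1 - fps_const (complex_of_real \<alpha>) * fps_X) \<cdot>\<^sub>m gen_fun q s"
proof (rule coef_eqI[where q = q])
  fix n
  have "plus_transform q \<alpha> s n \<in> carrier_mat q q" using assms by (simp add: plus_transform_def)
  then show "coef (gen_fun q (plus_transform q \<alpha> s)) n =
      coef ((1 - fps_const (complex_of_real \<alpha>) * fps_X) \<cdot>\<^sub>m gen_fun q s) n"
    using assms by (simp add: coef_X_poly_smult[OF gen_fun_carrier]) (simp add: plus_transform_def)
qed auto

lemma gen_fun_shifted:
  assumes s: "\<And>j. s j \<in> carrier_mat q q"
  shows "(1 - fps_const (complex_of_real \<alpha>) * fps_X) \<cdot>\<^sub>m gen_fun q s =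
    gen_const q (s 0) + fps_X \<cdot>\<^sub>m gen_fun q (shifted \<alpha> s)"
proof (rule coef_eqI[where q = q])
  fix n
  have c: "shifted \<alpha> s j \<in> carrier_mat q q" for j using s by (simp add: shifted_def)
  have z: "0\<^sub>m q q + s 0 = s 0 + 0\<^sub>m q q" using s by simp
  show "coef ((1 - fps_const (complex_of_real \<alpha>) * fps_X) \<cdot>\<^sub>m gen_fun q s) n =
      coef (gen_const q (s 0) + fps_X \<cdot>\<^sub>m gen_fun q (shifted \<alpha> s)) n"
  proof (cases n)
    case 0
    then show ?thesis using s c z by (simp add: coef_X_poly_smult[OF gen_fun_carrier] coef_add[of _ q] coef_X_smult[of _ q] coef_gen_const)
  next
    case (Suc k)
    then show ?thesis using s c left_add_zero_mat[OF c[of k]]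
      by (simp add: coef_X_poly_smult[OF gen_fun_carrier] coef_add[of _ q] coef_X_smult[of _ q] coef_gen_const) (simp add: shifted_def)
  qed
qed auto

definition fps_adjoint :: "nat \<Rightarrow> complex fps mat \<Rightarrow> complex fps mat" where
  "fps_adjoint q A = gen_fun q (\<lambda>n. mat_adjoint (coef A n))"

lemma fps_adjoint_carrier [simp]: "fps_adjoint q A \<in> carrier_mat q q"
  by (simp add: fps_adjoint_def)

lemma coef_fps_adjoint:
  "A \<in> carrier_mat q q \<Longrightarrow> coef (fps_adjoint q A) n = mat_adjoint (coef A n)"
  by (simp add: fps_adjoint_def)

lemma adjoint_msum:
  assumes "\<And>r. r \<in> I \<Longrightarrow> f r \<in> carrier_mat q q"
  shows "mat_adjoint (msum q f I) = msum q (\<lambda>r. mat_adjoint (f r)) I"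
proof (rule eq_matI)
  fix i j assume "i < dim_row (msum q (\<lambda>r. mat_adjoint (f r)) I)" "j < dim_col (msum q (\<lambda>r. mat_adjoint (f r)) I)"
  then have ij: "i < q" "j < q" by auto
  then show "mat_adjoint (msum q f I) $$ (i, j) = msum q (\<lambda>r. mat_adjoint (f r)) I $$ (i, j)"
    by (auto intro!: sum.cong dest!: assms)
qed auto

lemma fps_adjoint_mult:
  assumes A: "A \<in> carrier_mat q q" and B: "B \<in> carrier_mat q q"
  shows "fps_adjoint q (A * B) = fps_adjoint q B * fps_adjoint q A"
proof (rule coef_eqI[where q = q])
  fix n
  have "coef (fps_adjoint q (A * B)) n = mat_adjoint (msum q (\<lambda>i. coef A (n - i) * coef B i) {..n})"
    using coef_mult[OF A B] A B by (simp add: coef_fps_adjoint mult_carrier_mat[of _ q q])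
  also have "\<dots> = msum q (\<lambda>i. mat_adjoint (coef B i) * mat_adjoint (coef A (n - i))) {..n}"
    using A B by (subst adjoint_msum) (auto intro!: msum_eqI adjoint_mult mult_carrier_mat)
  also have "\<dots> = msum q (\<lambda>i. mat_adjoint (coef B (n - i)) * mat_adjoint (coef A i)) {..n}"
  proof (rule eq_matI)
    fix i j assume "i < dim_row (msum q (\<lambda>i. mat_adjoint (coef B (n - i)) * mat_adjoint (coef A i)) {..n})"
      "j < dim_col (msum q (\<lambda>i. mat_adjoint (coef B (n - i)) * mat_adjoint (coef A i)) {..n})"
    then have ij: "i < q" "j < q" by auto
    have "(\<Sum>k\<le>n. (mat_adjoint (coef B k) * mat_adjoint (coef A (n - k))) $$ (i, j)) =
      (\<Sum>k\<le>n. (mat_adjoint (coef B (n - k)) * mat_adjoint (coef A k)) $$ (i, j))"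
      by (rule sum.reindex_bij_witness[of _ "\<lambda>k. n - k" "\<lambda>k. n - k"]) auto
    then show "msum q (\<lambda>i. mat_adjoint (coef B i) * mat_adjoint (coef A (n - i))) {..n} $$ (i, j) =
       msum q (\<lambda>i. mat_adjoint (coef B (n - i)) * mat_adjoint (coef A i)) {..n} $$ (i, j)"
      using ij by simp
  qed auto
  also have "\<dots> = coef (fps_adjoint q B * fps_adjoint q A) n"
    using A B by (simp add: coef_mult[of _ q] coef_fps_adjoint)
  finally show "coef (fps_adjoint q (A * B)) n = coef (fps_adjoint q B * fps_adjoint q A) n" .
qed (auto intro!: mult_carrier_mat[of _ q q])

lemma smult_X_cancel:
  assumes "A \<in> carrier_mat q q" "B \<in> carrier_mat q q" "fps_X \<cdot>\<^sub>m A = fps_X \<cdot>\<^sub>m (B :: complex fps mat)"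
  shows "A = B"
proof (rule coef_eqI[OF assms(1,2)])
  fix n show "coef A n = coef B n"
    using coef_X_smult[OF assms(1), of "Suc n"] coef_X_smult[OF assms(2), of "Suc n"] assms(3) by simp
qed

section \<open>Pade remainders and block Hankel matrices\<close>

text \<open>The polynomial \<open>W\<close> is a right Pade denominator of \<open>h\<close>, normalised at 0, and \<open>L\<close> is the leading
  coefficient of the approximation error.\<close>

definition pade_remainder :: "nat \<Rightarrow> (nat \<Rightarrow> complex mat) \<Rightarrow> nat \<Rightarrow> complex mat \<Rightarrow> bool" where
  "pade_remainder q h n L \<longleftrightarrow> (\<exists>W \<in> carrier_mat q q. \<exists>N \<in> carrier_mat q q. \<exists>R \<in> carrier_mat q q.
     gen_fun q h * W = N + fps_X ^ (2 * n) \<cdot>\<^sub>m R \<and>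
     coef W 0 = 1\<^sub>m q \<and> (\<forall>i>n. coef W i = 0\<^sub>m q q) \<and>
     (\<forall>i\<ge>n. coef N i = 0\<^sub>m q q) \<and> coef R 0 = L)"

lemma pade_remainder_iff_coef:
  "pade_remainder q h n L \<longleftrightarrow> (\<exists>W \<in> carrier_mat q q.
     coef W 0 = 1\<^sub>m q \<and> (\<forall>i>n. coef W i = 0\<^sub>m q q) \<and>
     (\<forall>j<n. coef (gen_fun q h * W) (n + j) = 0\<^sub>m q q) \<and> coef (gen_fun q h * W) (2 * n) = L)" (is "?P \<longleftrightarrow> ?Q")
proof
  assume ?P
  then obtain W N R where c: "W \<in> carrier_mat q q" "N \<in> carrier_mat q q" "R \<in> carrier_mat q q"
    and eq: "gen_fun q h * W = N + fps_X ^ (2 * n) \<cdot>\<^sub>m R"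
    and W: "coef W 0 = 1\<^sub>m q" "\<forall>i>n. coef W i = 0\<^sub>m q q"
    and N: "\<forall>i\<ge>n. coef N i = 0\<^sub>m q q" and R: "coef R 0 = L"
    unfolding pade_remainder_def by blast
  have "coef (gen_fun q h * W) (n + j) = (if j < n then 0\<^sub>m q q else coef R (j - n))" for j
    using c N by (auto simp: eq coef_add coef_X_power_smult)
  from this[of n] this have "coef (gen_fun q h * W) (2 * n) = L" "\<forall>j<n. coef (gen_fun q h * W) (n + j) = 0\<^sub>m q q"
    using R by (auto simp: mult_2)
  then show ?Q using c W by blast
next
  assume ?Q
  then obtain W where W: "W \<in> carrier_mat q q" "coef W 0 = 1\<^sub>m q" "\<forall>i>n. coef W i = 0\<^sub>m q q"
    and z: "\<forall>j<n. coef (gen_fun q h * W) (n + j) = 0\<^sub>m q q" and L: "coef (gen_fun q h * W) (2 * n) = L"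
    by blast
  define A where "A = gen_fun q h * W"
  have A: "A \<in> carrier_mat q q" using W(1) by (simp add: A_def mult_carrier_mat[of _ q q])
  define N where "N = gen_fun q (\<lambda>i. if i < n then coef A i else 0\<^sub>m q q)"
  define R where "R = gen_fun q (\<lambda>i. coef A (2 * n + i))"
  have N: "coef N i = (if i < n then coef A i else 0\<^sub>m q q)" for i
    unfolding N_def using A by (subst coef_gen_fun) auto
  have R: "coef R i = coef A (2 * n + i)" for i
    unfolding R_def using A by (subst coef_gen_fun) auto
  have NR: "N \<in> carrier_mat q q" "R \<in> carrier_mat q q" by (simp_all add: N_def R_def)
  have "coef A i = coef (N + fps_X ^ (2 * n) \<cdot>\<^sub>m R) i" for i
  proof -
    consider "i < n" | "n \<le> i" "i < 2 * n" | "2 * n \<le> i" by linarith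
    then show ?thesis
    proof cases
      case 2
      then have "coef A i = 0\<^sub>m q q" using z[rule_format, of "i - n"] by (simp add: A_def)
      then show ?thesis using 2 NR by (simp add: coef_add coef_X_power_smult N)
    qed (use A NR in \<open>auto simp: coef_add coef_X_power_smult N R\<close>)
  qed
  then have "A = N + fps_X ^ (2 * n) \<cdot>\<^sub>m R"
    using A NR by (intro coef_eqI[of _ q]) auto
  moreover have "\<forall>i\<ge>n. coef N i = 0\<^sub>m q q" by (simp add: N)
  moreover have "coef R 0 = L" using L by (simp add: R A_def)
  ultimately show ?P unfolding pade_remainder_def A_def using W NR by blast
qed

text \<open>The coefficients of \<open>h W\<close> from \<open>n\<close> on are the block rows of an infinite block Hankel matrix, applied to
  the reversed coefficients of \<open>W\<close>.\<close>

lemma coef_monic_mult: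
  assumes h: "\<And>j. h j \<in> carrier_mat q q" and W: "W \<in> carrier_mat q q"
    "coef W 0 = 1\<^sub>m q" "\<forall>i>n. coef W i = 0\<^sub>m q q"
  shows "coef (gen_fun q h * W) (n + j) = h (n + j) + msum q (\<lambda>k. h (j + k) * coef W (n - k)) {..<n}"
proof -
  define F where "F i = h (n + j - i) * coef W i" for i
  have F: "F i \<in> carrier_mat q q" for i
    unfolding F_def using h W(1) by (auto intro!: mult_carrier_mat)
  have "coef (gen_fun q h * W) (n + j) = msum q F {..n + j}"
    unfolding F_def using h W(1) by (subst coef_mult) auto
  also have "\<dots> = msum q F {..n}"
  proof (rule eq_matI)
    fix a b assume "a < dim_row (msum q F {..n})" "b < dim_col (msum q F {..n})"
    then have ab: "a < q" "b < q" by auto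
    have "F i $$ (a, b) = 0" if "i > n" for i
      using that W(3) h ab by (simp add: F_def right_mult_zero_mat[OF h])
    then have "(\<Sum>i\<le>n + j. F i $$ (a, b)) = (\<Sum>i\<le>n. F i $$ (a, b))"
      by (intro sum.mono_neutral_right) (simp_all add: not_le)
    then show "msum q F {..n + j} $$ (a, b) = msum q F {..n} $$ (a, b)"
      using ab by simp
  qed auto
  also have "\<dots> = msum q F (insert 0 {1..n})"
    by (rule arg_cong[of _ _ "msum q F"]) auto
  also have "\<dots> = F 0 + msum q F {1..n}"
    using F by (intro msum_insert) auto
  also have "F 0 = h (n + j)" using right_mult_one_mat[OF h] by (simp add: F_def W(2))
  also have "msum q F {1..n} = msum q (\<lambda>k. h (j + k) * coef W (n - k)) {..<n}"
  proof (rule eq_matI)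
    fix a b assume "a < dim_row (msum q (\<lambda>k. h (j + k) * coef W (n - k)) {..<n})"
      "b < dim_col (msum q (\<lambda>k. h (j + k) * coef W (n - k)) {..<n})"
    then have ab: "a < q" "b < q" by auto
    have "(\<Sum>i\<in>{1..n}. F i $$ (a, b)) = (\<Sum>k<n. (h (j + k) * coef W (n - k)) $$ (a, b))"
      by (rule sum.reindex_bij_witness[of _ "\<lambda>k. n - k" "\<lambda>i. n - i"]) (auto simp: F_def add.commute)
    then show "msum q F {1..n} $$ (a, b) = msum q (\<lambda>k. h (j + k) * coef W (n - k)) {..<n} $$ (a, b)"
      using ab by simp
  qed auto
  finally show ?thesis .
qed

lemma block_hankel_carrier [simp]: "block_hankel q h n \<in> carrier_mat ((n + 1) * q) ((n + 1) * q)"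
  unfolding block_hankel_def by (rule block_mat_carrier)

lemma block_hankel_0: "h 0 \<in> carrier_mat q q \<Longrightarrow> block_hankel q h 0 = h 0"
  using block_mat_cong[of 1 1 "\<lambda>j k. h (j + k)" "\<lambda>_ _. h 0" q] block_mat_single[of "h 0" q]
  by (simp add: block_hankel_def)

lemma block_hankel_Suc:
  assumes h: "\<And>j. h j \<in> carrier_mat q q"
  shows "block_hankel q h (Suc n) = four_block_mat (block_hankel q h n)
    (block_mat q (Suc n) 1 (\<lambda>j _. h (Suc n + j))) (block_mat q 1 (Suc n) (\<lambda>_ k. h (Suc n + k)))
    (h (2 * Suc n))"
  unfolding block_hankel_def
  using block_mat_border[of "\<lambda>j k. h (j + k)" "Suc n" q] h by (simp add: add.commute mult_2)

text \<open>Each \<open>j \<le> 2 n\<close> is a sum of two admissible block indices.\<close>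

lemma block_hankel_hermitian_entries:
  assumes h: "\<And>j. h j \<in> carrier_mat q q" and H: "mat_adjoint (block_hankel q h n) = block_hankel q h n"
    and j: "j \<le> 2 * n"
  shows "mat_adjoint (h j) = h j"
proof -
  have "block_mat q (n + 1) (n + 1) (\<lambda>j k. mat_adjoint (h (k + j))) = block_mat q (n + 1) (n + 1) (\<lambda>j k. h (j + k))"
    using H h block_mat_adjoint[of "n + 1" "n + 1" "\<lambda>j k. h (j + k)" q] by (simp add: block_hankel_def)
  then have "\<forall>j<n + 1. \<forall>k<n + 1. mat_adjoint (h (k + j)) = h (j + k)"
    using h by (subst (asm) block_mat_eq_iff) auto
  moreover have "j div 2 < n + 1" "j - j div 2 < n + 1" "j - j div 2 + j div 2 = j" using j by auto
  ultimately show ?thesis by (metis add.commute)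
qed

lemma pade_remainder_0:
  assumes h: "\<And>j. h j \<in> carrier_mat q q"
  shows "pade_remainder q h 0 L \<longleftrightarrow> L = h 0"
proof -
  have *: "coef (gen_fun q h * W) 0 = h 0" if "W \<in> carrier_mat q q" "coef W 0 = 1\<^sub>m q" "\<forall>i>0. coef W i = 0\<^sub>m q q" for W
  proof -
    have "msum q (\<lambda>k. h (0 + k) * coef W (0 - k)) {..<0} = 0\<^sub>m q q" by (rule msum_zero) simp
    then show ?thesis using coef_monic_mult[of h q W 0 0, OF h that] h right_add_zero_mat[OF h] by simp
  qed
  define W where "W = gen_fun q (\<lambda>i. if i = 0 then 1\<^sub>m q else 0\<^sub>m q q)"
  have W: "W \<in> carrier_mat q q" "coef W 0 = 1\<^sub>m q" "\<forall>i>0. coef W i = 0\<^sub>m q q"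
    by (simp_all add: W_def)
  show ?thesis unfolding pade_remainder_iff_coef using * W by auto
qed

text \<open>The column \<open>Z\<close> consists of the coefficients of \<open>-W\<close> of degrees \<open>Suc n\<close> down to \<open>1\<close>. The vanishing
  coefficients of \<open>h W\<close> form the linear system for \<open>Z\<close>, and the remainder is the Schur complement.\<close>

lemma pade_remainder_Suc_iff:
  assumes h: "\<And>j. h j \<in> carrier_mat q q"
  shows "pade_remainder q h (Suc n) L \<longleftrightarrow> (\<exists>Z \<in> carrier_mat (Suc n * q) q.
    block_hankel q h n * Z = block_mat q (Suc n) 1 (\<lambda>j _. h (Suc n + j)) \<and>
    L = h (2 * Suc n) - block_mat q 1 (Suc n) (\<lambda>_ k. h (Suc n + k)) * Z)" (is "_ \<longleftrightarrow> ?R")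
proof -
  define m where "m = Suc n"
  have HZ: "block_hankel q h n * block_mat q m 1 (\<lambda>k _. z k) =
      block_mat q m 1 (\<lambda>j _. msum q (\<lambda>k. h (j + k) * z k) {..<m})"
    "block_mat q 1 m (\<lambda>_ k. h (m + k)) * block_mat q m 1 (\<lambda>k _. z k) =
      msum q (\<lambda>k. h (m + k) * z k) {..<m}"
    if z: "\<And>k. k < m \<Longrightarrow> z k \<in> carrier_mat q q" for z
  proof -
    show "block_hankel q h n * block_mat q m 1 (\<lambda>k _. z k) =
      block_mat q m 1 (\<lambda>j _. msum q (\<lambda>k. h (j + k) * z k) {..<m})"
      unfolding block_hankel_def using block_mat_mult[of m m "\<lambda>j k. h (j + k)" q 1 "\<lambda>k _. z k"] h z
      by (simp add: m_def)
    show "block_mat q 1 m (\<lambda>_ k. h (m + k)) * block_mat q m 1 (\<lambda>k _. z k) =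
      msum q (\<lambda>k. h (m + k) * z k) {..<m}"
      using block_mat_mult[of 1 m "\<lambda>_ k. h (m + k)" q 1 "\<lambda>k _. z k"] h z block_mat_single[of _ q] by simp
  qed
  have lin: "h j + msum q (\<lambda>k. h (i + k) * - z k) {..<m} = h j - msum q (\<lambda>k. h (i + k) * z k) {..<m}"
    if z: "\<And>k. k < m \<Longrightarrow> z k \<in> carrier_mat q q" for z i j
  proof -
    have "msum q (\<lambda>k. h (i + k) * - z k) {..<m} = msum q (\<lambda>k. - (h (i + k) * z k)) {..<m}"
      by (rule msum_eqI) (use carrier_matD[OF z] carrier_matD[OF h] in \<open>simp add: uminus_mult_right_mat\<close>)
    also have "\<dots> = - msum q (\<lambda>k. h (i + k) * z k) {..<m}"
      using z h by (intro msum_uminus) (auto intro!: mult_carrier_mat)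
    finally show ?thesis using h by (simp add: add_uminus_minus_mat[OF h])
  qed
  have "pade_remainder q h m L \<longleftrightarrow> ?R"
  proof
    assume "pade_remainder q h m L"
    then obtain W where W: "W \<in> carrier_mat q q" "coef W 0 = 1\<^sub>m q" "\<forall>i>m. coef W i = 0\<^sub>m q q"
      and z: "\<forall>j<m. coef (gen_fun q h * W) (m + j) = 0\<^sub>m q q" and L: "coef (gen_fun q h * W) (2 * m) = L"
      unfolding pade_remainder_iff_coef by blast
    define z where "z k = - coef W (m - k)" for k
    have zc: "z k \<in> carrier_mat q q" for k using W(1) by (simp add: z_def)
    have mz: "coef W (m - k) = - z k" for k using W(1) by (auto simp: z_def intro!: eq_matI)
    have e: "coef (gen_fun q h * W) (m + j) = h (m + j) - msum q (\<lambda>k. h (j + k) * z k) {..<m}" for j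
      using coef_monic_mult[of h q W m j, OF h W] lin[of z] zc by (simp add: mz)
    have "msum q (\<lambda>k. h (j + k) * z k) {..<m} = h (m + j)" if "j < m" for j
    proof (rule sym, rule minus_zero_imp_eq_mat[OF h msum_carrier])
      show "h (m + j) - msum q (\<lambda>k. h (j + k) * z k) {..<m} = 0\<^sub>m q q"
        using z[rule_format, OF that] e[of j] by simp
    qed
    then have "block_hankel q h n * block_mat q m 1 (\<lambda>k _. z k) = block_mat q m 1 (\<lambda>j _. h (m + j))"
      using HZ(1)[of z] zc by (auto intro!: block_mat_cong)
    moreover have "L = h (2 * m) - block_mat q 1 m (\<lambda>_ k. h (m + k)) * block_mat q m 1 (\<lambda>k _. z k)"
      using e[of m] L HZ(2)[of z] zc by (simp add: mult_2)
    moreover have "block_mat q m 1 (\<lambda>k _. z k) \<in> carrier_mat (m * q) q"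
      using block_mat_carrier[of q m 1] by simp
    ultimately show ?R unfolding m_def by blast
  next
    assume ?R
    then obtain Z where Z: "Z \<in> carrier_mat (m * q) q"
      "block_hankel q h n * Z = block_mat q m 1 (\<lambda>j _. h (m + j))"
      "L = h (2 * m) - block_mat q 1 m (\<lambda>_ k. h (m + k)) * Z" unfolding m_def by blast
    define z where "z k = mat q q (\<lambda>(i, j). Z $$ (k * q + i, j))" for k
    have zc: "z k \<in> carrier_mat q q" for k by (simp add: z_def)
    have Zz: "Z = block_mat q m 1 (\<lambda>k _. z k)" unfolding z_def by (rule block_column_eq[OF Z(1)])
    define W where "W = gen_fun q (\<lambda>i. if i = 0 then 1\<^sub>m q else if i \<le> m then - z (m - i) else 0\<^sub>m q q)"
    have W: "W \<in> carrier_mat q q" "coef W 0 = 1\<^sub>m q" "\<forall>i>m. coef W i = 0\<^sub>m q q"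
      using zc by (simp_all add: W_def)
    have mz: "coef W (m - k) = - z k" if "k < m" for k
      using that zc by (simp add: W_def)
    have e: "coef (gen_fun q h * W) (m + j) = h (m + j) - msum q (\<lambda>k. h (j + k) * z k) {..<m}" for j
    proof -
      have "msum q (\<lambda>k. h (j + k) * coef W (m - k)) {..<m} = msum q (\<lambda>k. h (j + k) * - z k) {..<m}"
        by (rule msum_eqI) (simp add: mz)
      then show ?thesis using coef_monic_mult[of h q W m j, OF h W] lin[of z] zc by simp
    qed
    have "block_mat q m 1 (\<lambda>j _. msum q (\<lambda>k. h (j + k) * z k) {..<m}) = block_mat q m 1 (\<lambda>j _. h (m + j))"
      using Z(2) HZ(1)[of z] zc by (simp add: Zz)
    then have "\<forall>j<m. \<forall>k<(1::nat). msum q (\<lambda>k. h (j + k) * z k) {..<m} = h (m + j)"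
      using h by (subst (asm) block_mat_eq_iff) auto
    then have "\<forall>j<m. coef (gen_fun q h * W) (m + j) = 0\<^sub>m q q"
      using h by (simp add: e minus_r_inv_mat[of _ q q])
    moreover have "coef (gen_fun q h * W) (2 * m) = L"
      using e[of m] Z(3) HZ(2)[of z] zc by (simp add: Zz mult_2)
    ultimately show "pade_remainder q h m L" unfolding pade_remainder_iff_coef using W by blast
  qed
  then show ?thesis by (simp add: m_def)
qed

lemma schur_L_Suc:
  "schur_L q h (Suc n) = h (2 * Suc n) - block_mat q 1 (Suc n) (\<lambda>_ k. h (Suc n + k)) *
     pinv (block_hankel q h n) * block_mat q (Suc n) 1 (\<lambda>j _. h (Suc n + j))"
  by (simp add: schur_L_def)

lemma hankel_row_eq_adjoint_column:
  assumes h: "\<And>j. h j \<in> carrier_mat q q" and herm: "\<And>j. j < 2 * Suc n \<Longrightarrow> mat_adjoint (h j) = h j"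
  shows "block_mat q 1 (Suc n) (\<lambda>_ k. h (Suc n + k)) =
    mat_adjoint (block_mat q (Suc n) 1 (\<lambda>j _. h (Suc n + j)))"
  using block_mat_adjoint[of "Suc n" 1 "\<lambda>j _. h (Suc n + j)" q] h herm
  by (auto intro!: block_mat_cong)

text \<open>Write \<open>H\<close> for the smaller Hankel matrix and \<open>B = H Z\<close> for its bordering column. Then
  \<open>B* H\<^sup>\<dagger> B = Z* H H\<^sup>\<dagger> H Z = B* Z\<close>, whatever solution \<open>Z\<close> is taken.\<close>

lemma schur_L_eq_pade_remainder_Suc:
  assumes h: "\<And>j. h j \<in> carrier_mat q q" and herm: "\<And>j. j < 2 * Suc n \<Longrightarrow> mat_adjoint (h j) = h j"
    and nn: "nonneg_hermitian (block_hankel q h n)" and L: "pade_remainder q h (Suc n) L"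
  shows "schur_L q h (Suc n) = L"
proof -
  define H where "H = block_hankel q h n"
  define B where "B = block_mat q (Suc n) 1 (\<lambda>j _. h (Suc n + j))"
  define N where "N = Suc n * q"
  obtain Z where Z: "Z \<in> carrier_mat N q" "H * Z = B" "L = h (2 * Suc n) - mat_adjoint B * Z"
    using L hankel_row_eq_adjoint_column[of h q n, OF h herm] unfolding pade_remainder_Suc_iff[of h q n, OF h] H_def B_def N_def by auto
  have H: "H \<in> carrier_mat N N" using block_hankel_carrier[of q h n] by (simp add: H_def N_def)
  have Hh: "mat_adjoint H = H" using nn by (simp add: nonneg_hermitian_def H_def)
  note mp = moore_penrose_nonneg_hermitian[OF H nn[folded H_def]]
  have Bs: "mat_adjoint B = mat_adjoint Z * H" using adjoint_mult[OF H Z(1)] Hh Z(2) by simp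
  have Zs: "mat_adjoint Z \<in> carrier_mat q N" using Z(1) by simp
  have HP: "H * pinv H \<in> carrier_mat N N" using H mp(1) by (rule mult_carrier_mat)
  have "mat_adjoint B * pinv H * B = mat_adjoint Z * (H * pinv H) * (H * Z)"
    unfolding Bs using assoc_mult_mat[OF Zs H mp(1)] Z(2) by simp
  also have "\<dots> = mat_adjoint Z * (H * pinv H * H) * Z"
    using Zs H HP Z(1) assoc_mult_mat[OF mult_carrier_mat[OF Zs HP] H Z(1)] assoc_mult_mat[OF Zs HP H] by simp
  also have "\<dots> = mat_adjoint B * Z" unfolding mp(4) Bs ..
  finally show ?thesis
    unfolding schur_L_Suc using hankel_row_eq_adjoint_column[of h q n, OF h herm] Z(3) by (simp add: H_def B_def)
qed

lemma hankel_nonneg_Suc_iff: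
  assumes h: "\<And>j. h j \<in> carrier_mat q q" and herm: "\<And>j. j < 2 * Suc n \<Longrightarrow> mat_adjoint (h j) = h j"
  shows "nonneg_hermitian (block_hankel q h (Suc n)) \<longleftrightarrow>
    nonneg_hermitian (block_hankel q h n) \<and> (\<exists>L. pade_remainder q h (Suc n) L \<and> nonneg_hermitian L)"
proof -
  define H where "H = block_hankel q h n"
  define B where "B = block_mat q (Suc n) 1 (\<lambda>j _. h (Suc n + j))"
  define N where "N = Suc n * q"
  define C where "C = h (2 * Suc n)"
  have c: "H \<in> carrier_mat N N" "B \<in> carrier_mat N q" "C \<in> carrier_mat q q"
    using block_hankel_carrier[of q h n] block_mat_carrier[of q "Suc n" 1] h
    by (auto simp: H_def B_def N_def C_def)
  have M: "block_hankel q h (Suc n) = four_block_mat H B (mat_adjoint B) C"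
    using block_hankel_Suc[of h q n, OF h] hankel_row_eq_adjoint_column[of h q n, OF h herm] by (simp add: H_def B_def C_def)
  have P: "pade_remainder q h (Suc n) L \<longleftrightarrow> (\<exists>Z \<in> carrier_mat N q. H * Z = B \<and> L = C - mat_adjoint B * Z)" for L
    unfolding pade_remainder_Suc_iff[of h q n, OF h] using hankel_row_eq_adjoint_column[of h q n, OF h herm]
    by (simp add: H_def B_def C_def N_def)
  show ?thesis
  proof
    assume nn: "nonneg_hermitian (block_hankel q h (Suc n))"
    have H: "nonneg_hermitian H" by (rule nonneg_hermitian_block_corner(1)[OF c nn[unfolded M]])
    then have Hh: "mat_adjoint H = H" by (simp add: nonneg_hermitian_def)
    note mp = moore_penrose_nonneg_hermitian[OF c(1) H]
    have Z: "pinv H * B \<in> carrier_mat N q" using mp(1) c(2) by (rule mult_carrier_mat)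
    have HZ: "H * (pinv H * B) = B"
      by (rule nonneg_hermitian_block_range[OF c nn[unfolded M] mp(1,2,4)])
    have "nonneg_hermitian (C - mat_adjoint B * (pinv H * B))"
      using nonneg_hermitian_block_iff[OF c(1) Hh Z HZ c(3)] nn M by simp
    then show "nonneg_hermitian (block_hankel q h n) \<and> (\<exists>L. pade_remainder q h (Suc n) L \<and> nonneg_hermitian L)"
      using H P Z HZ unfolding H_def by blast
  next
    assume a: "nonneg_hermitian (block_hankel q h n) \<and> (\<exists>L. pade_remainder q h (Suc n) L \<and> nonneg_hermitian L)"
    then obtain Z where Z: "Z \<in> carrier_mat N q" "H * Z = B" "nonneg_hermitian (C - mat_adjoint B * Z)"
      unfolding P by blast
    have Hh: "mat_adjoint H = H" using a by (simp add: nonneg_hermitian_def H_def)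
    show "nonneg_hermitian (block_hankel q h (Suc n))"
      unfolding M using nonneg_hermitian_block_iff[OF c(1) Hh Z(1,2) c(3)] Z(3) a by (simp add: H_def)
  qed
qed

text \<open>Iterating Albert's criterion along the chain of leading principal blocks replaces positivity of a large
  matrix by conditions on \<open>q\<close> by \<open>q\<close> matrices that are visible in the generating function.\<close>

lemma hankel_nonneg_iff:
  assumes h: "\<And>j. h j \<in> carrier_mat q q" and herm: "\<And>j. j < 2 * n \<Longrightarrow> mat_adjoint (h j) = h j"
  shows "nonneg_hermitian (block_hankel q h n) \<longleftrightarrow>
    (\<forall>i\<le>n. \<exists>L. pade_remainder q h i L \<and> nonneg_hermitian L)"
  using herm
proof (induction n)
  case 0
  then show ?case using h by (simp add: pade_remainder_0 block_hankel_0)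
next
  case (Suc n)
  then show ?case
    using hankel_nonneg_Suc_iff[of h q n, OF h Suc.prems] by (auto simp: le_Suc_eq)
qed

lemma schur_L_eq_pade_remainder:
  assumes h: "\<And>j. h j \<in> carrier_mat q q" and nn: "nonneg_hermitian (block_hankel q h n)"
    and i: "i \<le> n" and L: "pade_remainder q h i L"
  shows "schur_L q h i = L"
proof (cases i)
  case 0
  then show ?thesis using L h by (simp add: pade_remainder_0 schur_L_def)
next
  case (Suc k)
  have herm: "mat_adjoint (h j) = h j" if "j \<le> 2 * n" for j
    using block_hankel_hermitian_entries[of h q n j, OF h _ that] nn by (simp add: nonneg_hermitian_def)
  have "nonneg_hermitian (block_hankel q h k)"
    using nn hankel_nonneg_iff[of h q n, OF h] hankel_nonneg_iff[of h q k, OF h] herm i Suc by auto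
  then show ?thesis
    using schur_L_eq_pade_remainder_Suc[of h q k L, OF h] herm i Suc L by auto
qed

section \<open>The Schur transform on the range of the first entry\<close>

text \<open>Sequences of Hermitian matrices that live in the corner of the matrix ring cut out by the orthogonal
  projection onto the range of the first entry. There is no bound on the indices: a finite sequence is
  continued by zeros, which keeps all identities of generating functions exact. In names of facts, \<open>U\<close>,
  \<open>R\<close> and \<open>T\<close> stand for the generating functions of \<open>u\<close>, \<open>r\<close> and \<open>t\<close>, and \<open>D\<close> for the constant \<open>d\<close>.\<close>

locale corner_sequence =
  fixes q :: nat and \<alpha> :: real and s :: "nat \<Rightarrow> complex mat"
  assumes s_carrier: "s j \<in> carrier_mat q q"
    and s_hermitian: "mat_adjoint (s j) = s j"
    and s_corner: "s 0 * pinv (s 0) * s j = s j"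
    and s0_nonneg: "nonneg_hermitian (s 0)"
begin

lemmas prods = assoc_mult_mat[of _ q q _ q _ q] mult_carrier_mat[of _ q q _ q]
  add_mult_distrib_mat[of _ q q _ _ q] mult_add_distrib_mat[of _ q q _ q]
  minus_mult_distrib_mat[of _ q q _ _ q] mult_minus_distrib_mat[of _ q q _ q]
  mult_smult_distrib[of _ q q _ q] mult_smult_assoc_mat[of _ q q _ q]

abbreviation "d \<equiv> pinv (s 0)"
abbreviation "P \<equiv> s 0 * d"
abbreviation "u \<equiv> plus_transform q \<alpha> s"
abbreviation "r \<equiv> reciprocal q u"
abbreviation "t \<equiv> schur_transform1 q \<alpha> s"

lemma pinv_s0: "d \<in> carrier_mat q q" "mat_adjoint d = d" "P = d * s 0" "P * s 0 = s 0" "P * d = d"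
  using moore_penrose_nonneg_hermitian[OF s_carrier[of 0] s0_nonneg] by auto

lemma projection: "P \<in> carrier_mat q q" "mat_adjoint P = P" "P * P = P"
proof -
  show P: "P \<in> carrier_mat q q" using s_carrier[of 0] pinv_s0(1) by (rule mult_carrier_mat)
  show "mat_adjoint P = P" using adjoint_mult[OF s_carrier[of 0] pinv_s0(1)] pinv_s0(2,3) s_hermitian[of 0] by simp
  show "P * P = P" using assoc_mult_mat[OF P s_carrier[of 0] pinv_s0(1)] pinv_s0(4) by simp
qed

lemma s_P: "s j * P = s j"
  using arg_cong[OF s_corner[of j], of mat_adjoint] adjoint_mult[OF projection(1) s_carrier[of j]] projection(2) s_hermitian[of j]
  by simp

lemma shifted_carrier: "shifted \<alpha> s j \<in> carrier_mat q q"
  using s_carrier by (simp add: shifted_def)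

lemma u_carrier: "u j \<in> carrier_mat q q"
  using s_carrier by (simp add: plus_transform_def)

lemma u_0: "u 0 = s 0"
  using s_carrier[of 0] by (simp add: plus_transform_def)

lemma u_corner: "P * u j = u j"
proof (cases j)
  case 0
  then show ?thesis using s_corner[of 0] u_0 by simp
next
  case (Suc k)
  then show ?thesis
    unfolding plus_transform_def using mult_add_distrib_mat[OF projection(1), of "(- complex_of_real \<alpha>) \<cdot>\<^sub>m s k" q "s j"]
      mult_smult_distrib[OF projection(1) s_carrier] s_corner s_carrier
    by simp
qed

lemma u_hermitian: "mat_adjoint (u j) = u j"
  using s_hermitian s_carrier
  by (simp add: plus_transform_def adjoint_add[of _ q q] adjoint_smult)

lemma r_carrier: "r j \<in> carrier_mat q q"
  using u_carrier[of 0] pinv_s0(1) by (subst reciprocal.simps) (auto simp: u_0 intro!: mult_carrier_mat[of _ q q])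

lemma r_corner: "P * r j = r j"
proof (cases "j = 0")
  case True
  then show ?thesis using pinv_s0(5) by (subst (1 2) reciprocal.simps) (simp add: u_0)
next
  case False
  define M where "M = msum q (\<lambda>l. u (j - l) * r l) {..<j}"
  have M: "M \<in> carrier_mat q q" by (simp add: M_def)
  have "r j = - (d * M)" using False by (subst reciprocal.simps) (simp add: u_0 M_def)
  moreover have "P * (d * M) = d * M" using assoc_mult_mat[OF projection(1) pinv_s0(1) M] pinv_s0(5) by simp
  ultimately show ?thesis using projection(1) M pinv_s0(1) carrier_matD[OF s_carrier[of 0]] carrier_matD[OF projection(1)]
    by (simp add: uminus_mult_right_mat carrier_matD)
qed

text \<open>Multiplying the recursion of the reciprocal sequence by \<open>s 0\<close> gives the vanishing of the higher
  coefficients, since \<open>P\<close> fixes every \<open>u j\<close>.\<close>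

lemma UR: "gen_fun q u * gen_fun q r = gen_const q P"
proof (rule coef_eqI[where q = q])
  fix n
  have ur: "u i * r j \<in> carrier_mat q q" for i j
    using u_carrier r_carrier by (rule mult_carrier_mat)
  have "coef (gen_fun q u * gen_fun q r) n = msum q (\<lambda>i. u (n - i) * r i) {..n}"
    using u_carrier r_carrier by (simp add: coef_mult[of _ q])
  also have "{..n} = insert n {..<n}" by auto
  also have "msum q (\<lambda>i. u (n - i) * r i) (insert n {..<n}) =
      s 0 * r n + msum q (\<lambda>i. u (n - i) * r i) {..<n}"
    using ur ur[of 0 n] by (subst msum_insert) (auto simp: u_0)
  also have "\<dots> = coef (gen_const q P) n"
  proof (cases "n = 0")
    case True
    have "msum q (\<lambda>i. u (n - i) * r i) {..<n} = 0\<^sub>m q q" by (rule msum_zero) (simp add: True)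
    moreover have "r 0 = d" by (subst reciprocal.simps) (simp add: u_0)
    ultimately show ?thesis using True projection(1) by (simp add: coef_gen_const)
  next
    case False
    define M where "M = msum q (\<lambda>l. u (n - l) * r l) {..<n}"
    have M: "M \<in> carrier_mat q q" by (simp add: M_def)
    have "r n = - (d * M)" using False by (subst reciprocal.simps) (simp add: u_0 M_def)
    then have "s 0 * r n = - (P * M)"
      using s_carrier[of 0] pinv_s0(1) M by (simp add: prods)
    also have "P * M = M"
      unfolding M_def using ur projection(1) u_corner u_carrier r_carrier
      by (subst msum_mult_left) (auto intro!: msum_eqI simp: assoc_mult_mat[symmetric, of _ q q _ q _ q])
    finally have "s 0 * r n + M = 0\<^sub>m q q" using M by simp
    then show ?thesis using False projection(1) by (simp add: M_def coef_gen_const)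
  qed
  finally show "coef (gen_fun q u * gen_fun q r) n = coef (gen_const q P) n" .
qed (auto intro!: mult_carrier_mat[of _ q q])

lemma fps_adjoint_U: "fps_adjoint q (gen_fun q u) = gen_fun q u"
  using u_carrier u_hermitian by (intro coef_eqI[of _ q]) (auto simp: coef_fps_adjoint)

lemma fps_adjoint_gen_const_P: "fps_adjoint q (gen_const q P) = gen_const q P"
  using projection by (intro coef_eqI[of _ q]) (auto simp: coef_fps_adjoint coef_gen_const)

lemma gen_const_P_R: "gen_const q P * gen_fun q r = gen_fun q r"
  using projection r_carrier r_corner
  by (intro coef_eqI[of _ q]) (auto simp: coef_gen_const_mult intro!: mult_carrier_mat[of _ q q])

lemma gen_const_P_U: "gen_const q P * gen_fun q u = gen_fun q u"
  using projection u_carrier u_corner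
  by (intro coef_eqI[of _ q]) (auto simp: coef_gen_const_mult intro!: mult_carrier_mat[of _ q q])

text \<open>The adjoint of \<open>R\<close> is a left inverse of \<open>U\<close> in the corner ring and \<open>R\<close> is a right inverse, so the two
  coincide. In particular \<open>R\<close> is a two-sided inverse and has Hermitian coefficients.\<close>

lemma fps_adjoint_R: "fps_adjoint q (gen_fun q r) = gen_fun q r"
proof -
  let ?R' = "fps_adjoint q (gen_fun q r)"
  have "?R' = ?R' * gen_const q P"
    using arg_cong[OF gen_const_P_R, of "fps_adjoint q"] by (simp add: fps_adjoint_mult fps_adjoint_gen_const_P)
  also have "\<dots> = ?R' * gen_fun q u * gen_fun q r"
    using assoc_mult_mat[of ?R' q q "gen_fun q u" q "gen_fun q r" q] by (simp add: UR)
  also have "?R' * gen_fun q u = gen_const q P"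
    using arg_cong[OF UR, of "fps_adjoint q"] by (simp add: fps_adjoint_mult fps_adjoint_gen_const_P fps_adjoint_U)
  finally show ?thesis by (simp add: gen_const_P_R)
qed

lemma RU: "gen_fun q r * gen_fun q u = gen_const q P"
  using arg_cong[OF UR, of "fps_adjoint q"]
  by (simp add: fps_adjoint_mult fps_adjoint_gen_const_P fps_adjoint_U fps_adjoint_R)

lemma r_hermitian: "mat_adjoint (r j) = r j"
  using arg_cong[OF fps_adjoint_R, of "\<lambda>A. coef A j"] r_carrier by (simp add: coef_fps_adjoint)

lemma t_carrier: "t j \<in> carrier_mat q q"
  unfolding schur_transform1_def using s_carrier[of 0] r_carrier[of "j + 1"] by (auto intro!: mult_carrier_mat[of _ q q])

lemma t_hermitian: "mat_adjoint (t j) = t j"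
  unfolding schur_transform1_def using s_carrier[of 0] r_carrier[of "j + 1"] s_hermitian[of 0] r_hermitian[of "j + 1"]
  by (simp add: adjoint_uminus adjoint_mult[of _ q q _ q] prods)

lemma t_P: "t j * P = t j"
proof -
  have "s 0 * r (j + 1) * s 0 * P = s 0 * r (j + 1) * s 0"
    using assoc_mult_mat[OF mult_carrier_mat[OF s_carrier[of 0] r_carrier[of "j + 1"]] s_carrier[of 0] projection(1)] s_P[of 0]
    by simp
  then show ?thesis unfolding schur_transform1_def
    using s_carrier[of 0] carrier_matD[OF s_carrier[of 0]] carrier_matD[OF projection(1)] by (simp add: uminus_mult_left_mat)
qed

text \<open>The constant term on the right vanishes because of \<open>s 0 * d * s 0 = s 0\<close>.\<close>

lemma X_T: "fps_X \<cdot>\<^sub>m gen_fun q t = gen_const q (s 0) - gen_const q (s 0) * (gen_fun q r * gen_const q (s 0))"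
proof (rule coef_eqI[where q = q])
  fix n
  have c: "gen_fun q r * gen_const q (s 0) \<in> carrier_mat q q" "gen_const q (s 0) * (gen_fun q r * gen_const q (s 0)) \<in> carrier_mat q q"
    by (auto intro!: mult_carrier_mat[of _ q q])
  have "coef (gen_const q (s 0) - gen_const q (s 0) * (gen_fun q r * gen_const q (s 0))) n =
    (if n = 0 then s 0 else 0\<^sub>m q q) - s 0 * (r n * s 0)"
    using c s_carrier[of 0] r_carrier by (simp add: coef_minus[of _ q] coef_gen_const coef_gen_const_mult coef_mult_gen_const)
  also have "\<dots> = (if n = 0 then 0\<^sub>m q q else t (n - 1))"
  proof (cases "n = 0")
    case True
    have "r 0 = d" by (subst reciprocal.simps) (simp add: u_0)
    then show ?thesis
      using True pinv_s0(3,4) s_carrier[of 0] pinv_s0(1) assoc_mult_mat[OF s_carrier[of 0] pinv_s0(1) s_carrier[of 0]]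
      by (simp add: minus_r_inv_mat[of _ q q])
  next
    case False
    have "s 0 * (r n * s 0) \<in> carrier_mat q q" using s_carrier[of 0] r_carrier by (auto intro!: mult_carrier_mat[of _ q q])
    then have "0\<^sub>m q q - s 0 * (r n * s 0) = - (s 0 * (r n * s 0))" by (rule zero_minus_mat)
    then show ?thesis
      using False assoc_mult_mat[OF s_carrier[of 0] r_carrier[of n] s_carrier[of 0]] by (simp add: schur_transform1_def)
  qed
  finally show "coef (fps_X \<cdot>\<^sub>m gen_fun q t) n = coef (gen_const q (s 0) - gen_const q (s 0) * (gen_fun q r * gen_const q (s 0))) n"
    using t_carrier by (simp add: coef_X_smult[of _ q])
qed (auto intro!: mult_carrier_mat[of _ q q] minus_carrier_mat)

lemma U_eq: "gen_fun q u = gen_const q (s 0) + fps_X \<cdot>\<^sub>m gen_fun q (shifted \<alpha> s)"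
  using gen_fun_plus_transform[of s q \<alpha>, OF s_carrier] gen_fun_shifted[of s q \<alpha>, OF s_carrier] by simp

text \<open>In the corner ring \<open>X T = s\<^sub>0 - s\<^sub>0 R s\<^sub>0\<close>; multiplication by \<open>d U\<close> gives \<open>U - s\<^sub>0\<close>, which is \<open>X\<close> times the
  generating function of the shifted sequence.\<close>

lemma T_D_U: "gen_fun q t * (gen_const q d * gen_fun q u) = gen_fun q (shifted \<alpha> s)"
proof (rule smult_X_cancel)
  let ?S = "gen_const q (s 0)" and ?D = "gen_const q d" and ?U = "gen_fun q u" and ?R = "gen_fun q r" and ?P = "gen_const q P"
  have SD: "?S * ?D = ?P" using s_carrier[of 0] pinv_s0(1) by (simp add: gen_const_mult)
  have SP: "?S * ?P = ?S" using s_carrier[of 0] projection(1) s_P[of 0] by (simp add: gen_const_mult)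
  have SDU: "?S * (?D * ?U) = ?U"
    using assoc_mult_mat[of ?S q q ?D q ?U q] by (simp add: SD gen_const_P_U)
  have "fps_X \<cdot>\<^sub>m (gen_fun q t * (?D * ?U)) = (?S - ?S * (?R * ?S)) * (?D * ?U)"
    unfolding X_T[symmetric] by (simp add: prods)
  also have "\<dots> = ?S * (?D * ?U) - ?S * (?R * (?S * (?D * ?U)))"
    by (simp add: prods)
  also have "\<dots> = ?U - ?S" by (simp add: SDU RU SP)
  also have "\<dots> = fps_X \<cdot>\<^sub>m gen_fun q (shifted \<alpha> s)"
    unfolding U_eq by (intro eq_matI) auto
  finally show "fps_X \<cdot>\<^sub>m (gen_fun q t * (?D * ?U)) = fps_X \<cdot>\<^sub>m gen_fun q (shifted \<alpha> s)" .
qed (auto intro!: mult_carrier_mat[of _ q q])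

lemma gen_fun_mult_complement: "gen_fun q h * gen_const q (1\<^sub>m q - P) = 0\<^sub>m q q"
  if h: "\<And>j. h j \<in> carrier_mat q q" and hP: "\<And>j. h j * P = h j"
proof (rule coef_eqI[where q = q])
  fix n
  have Q: "1\<^sub>m q - P \<in> carrier_mat q q" using projection(1) by (rule minus_carrier_mat)
  have "h n * (1\<^sub>m q - P) = 0\<^sub>m q q"
    using mult_minus_distrib_mat[OF h one_carrier_mat projection(1), of n] hP[of n] right_mult_one_mat[OF h]
      minus_r_inv_mat[OF h] by simp
  then show "coef (gen_fun q h * gen_const q (1\<^sub>m q - P)) n = coef (0\<^sub>m q q) n"
    using Q h by (auto simp: coef_mult_gen_const intro!: eq_matI)
qed (auto intro!: mult_carrier_mat[of _ q q])

text \<open>With \<open>V = s\<^sub>0 W + X N = U W + O(X^(2n+1))\<close>, a polynomial of degree at most \<open>n\<close>, the identity \<open>T_D_U\<close> gives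
  \<open>T d V = h W + O(X^(2n+1))\<close>, where \<open>h\<close> is the series of the shifted sequence. The summand \<open>1 - P\<close>
  restores the normalisation \<open>W'(0) = 1\<close>; it is annihilated by \<open>T\<close>.\<close>

lemma pade_remainder_transform:
  assumes "pade_remainder q (shifted \<alpha> s) n L"
  shows "pade_remainder q t n L"
proof -
  let ?S = "gen_const q (s 0)" and ?D = "gen_const q d" and ?U = "gen_fun q u" and ?T = "gen_fun q t"
    and ?H = "gen_fun q (shifted \<alpha> s)" and ?Q = "gen_const q (1\<^sub>m q - P)"
  obtain W N R where c: "W \<in> carrier_mat q q" "N \<in> carrier_mat q q" "R \<in> carrier_mat q q"
    and eq: "?H * W = N + fps_X ^ (2 * n) \<cdot>\<^sub>m R"
    and W: "coef W 0 = 1\<^sub>m q" "\<And>i. i > n \<Longrightarrow> coef W i = 0\<^sub>m q q"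
    and N: "\<And>i. i \<ge> n \<Longrightarrow> coef N i = 0\<^sub>m q q" and R: "coef R 0 = L"
    using assms unfolding pade_remainder_def by blast
  have Q: "1\<^sub>m q - P \<in> carrier_mat q q" using projection(1) by (rule minus_carrier_mat)
  define V where "V = ?S * W + fps_X \<cdot>\<^sub>m N"
  define W' where "W' = ?D * V + ?Q"
  define R' where "R' = R - fps_X \<cdot>\<^sub>m (?T * (?D * R))"
  have V: "V \<in> carrier_mat q q" and DV: "?D * V \<in> carrier_mat q q" and DR: "?D * R \<in> carrier_mat q q"
    and TDR: "?T * (?D * R) \<in> carrier_mat q q" and UW: "?U * W \<in> carrier_mat q q" and HW: "?H * W \<in> carrier_mat q q"
    and SW: "?S * W \<in> carrier_mat q q" and DUW: "?D * (?U * W) \<in> carrier_mat q q"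
    using c by (auto simp: V_def intro!: mult_carrier_mat[of _ q q] add_carrier_mat)
  have W': "W' \<in> carrier_mat q q" and R': "R' \<in> carrier_mat q q"
    using DV TDR by (auto simp: W'_def R'_def minus_carrier_mat)
  have "?U * W = ?S * W + fps_X \<cdot>\<^sub>m (?H * W)"
    unfolding U_eq using c by (simp add: prods)
  then have Ve: "V = ?U * W - fps_X ^ (2 * n + 1) \<cdot>\<^sub>m R"
    unfolding V_def eq using c SW by (intro eq_matI) (auto simp: algebra_simps simp del: index_mult_mat(1))
  have "?T * W' = ?T * (?D * V) + ?T * ?Q"
    unfolding W'_def using DV by (intro mult_add_distrib_mat) auto
  also have "?T * ?Q = 0\<^sub>m q q" by (rule gen_fun_mult_complement[OF t_carrier t_P])
  also have "?T * (?D * V) + 0\<^sub>m q q = ?T * (?D * V)"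
    using DV by (intro right_add_zero_mat) (auto intro!: mult_carrier_mat[of _ q q])
  also have "\<dots> = ?T * (?D * (?U * W)) - fps_X ^ (2 * n + 1) \<cdot>\<^sub>m (?T * (?D * R))"
    unfolding Ve using c UW DUW DR by (simp add: prods)
  also have "?T * (?D * (?U * W)) = ?H * W"
    using c UW DUW T_D_U
    by (metis assoc_mult_mat[of ?D q q ?U q W q] assoc_mult_mat[of ?T q q "?D * ?U" q W q] gen_const_carrier gen_fun_carrier mult_carrier_mat)
  also have "?H * W - fps_X ^ (2 * n + 1) \<cdot>\<^sub>m (?T * (?D * R)) = N + fps_X ^ (2 * n) \<cdot>\<^sub>m R'"
    unfolding eq R'_def using c TDR by (intro eq_matI) (auto simp: algebra_simps simp del: index_mult_mat(1))
  finally have "?T * W' = N + fps_X ^ (2 * n) \<cdot>\<^sub>m R'" .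
  moreover have cW': "coef W' i = d * (s 0 * coef W i + (if i = 0 then 0\<^sub>m q q else coef N (i - 1)))
      + (if i = 0 then 1\<^sub>m q - P else 0\<^sub>m q q)" for i
    unfolding W'_def V_def using c SW V[unfolded V_def] DV[unfolded V_def] Q pinv_s0(1) s_carrier[of 0]
    by (simp add: coef_add[of _ q] coef_gen_const_mult coef_gen_const coef_X_smult[of _ q])
  moreover have "coef W' 0 = 1\<^sub>m q"
  proof -
    have "coef W' 0 = P + (1\<^sub>m q - P)"
      using cW'[of 0] W(1) right_mult_one_mat[OF s_carrier[of 0]] right_add_zero_mat[OF s_carrier[of 0]] pinv_s0(3)
      by simp
    then show ?thesis using add_minus_cancel_mat[OF projection(1) one_carrier_mat] by simp
  qed
  moreover have "\<forall>i>n. coef W' i = 0\<^sub>m q q"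
  proof (intro allI impI)
    fix i assume i: "i > n"
    then have "coef W' i = d * (s 0 * 0\<^sub>m q q + 0\<^sub>m q q) + 0\<^sub>m q q"
      using cW'[of i] W(2)[OF i] N[of "i - 1"] by simp
    then show "coef W' i = 0\<^sub>m q q"
      using right_mult_zero_mat[OF s_carrier[of 0]] right_mult_zero_mat[OF pinv_s0(1)] by simp
  qed
  moreover have "coef R' 0 = L"
  proof -
    have "coef R' 0 = L - 0\<^sub>m q q"
      unfolding R'_def using c TDR R by (simp add: coef_minus[of _ q] coef_X_smult[of _ q])
    moreover have "L \<in> carrier_mat q q" using R c(3) by auto
    ultimately show ?thesis by (auto intro!: eq_matI)
  qed
  ultimately show ?thesis
    unfolding pade_remainder_def using W' c(2) R' N by blast
qed

lemma shifted_t_carrier: "shifted \<alpha> t j \<in> carrier_mat q q"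
  using t_carrier by (simp add: shifted_def)

lemma shifted_t_P: "shifted \<alpha> t j * P = shifted \<alpha> t j"
  unfolding shifted_def using projection(1) t_P t_carrier by (simp add: prods)

text \<open>Multiply \<open>T d (1 - \<alpha>X) S = h\<close>, with \<open>h\<close> the series of the shifted sequence, by \<open>X W\<close> and insert
  \<open>S W = N + O(X^(2m))\<close>. Up to a polynomial of degree at most \<open>m\<close> this yields
  \<open>X\<^sup>2 T\<^sub>\<alpha> d N = L X^(2m) + O(X^(2m+1))\<close>. Division by \<open>X\<^sup>2\<close> shows that \<open>d N\<close>, whose degree is at most \<open>m - 1\<close>,
  is a denominator for the shifted transform.\<close>

lemma pade_remainder_shifted_transform:
  assumes "pade_remainder q s (Suc n) L"
  shows "pade_remainder q (shifted \<alpha> t) n L"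
proof -
  define X where "X = (fps_X :: complex fps)"
  define b where "b = 1 - fps_const (complex_of_real \<alpha>) * fps_X"
  define m where "m = Suc n"
  let ?K = "gen_const q (s 0)" and ?S = "gen_fun q s" and ?D = "gen_const q d" and ?U = "gen_fun q u" and ?T = "gen_fun q t"
    and ?H = "gen_fun q (shifted \<alpha> s)" and ?Q = "gen_const q (1\<^sub>m q - P)" and ?C = "gen_const q (t 0)" and ?A = "gen_fun q (shifted \<alpha> t)"
  obtain W N R where c: "W \<in> carrier_mat q q" "N \<in> carrier_mat q q" "R \<in> carrier_mat q q"
    and eq: "?S * W = N + X ^ (2 * m) \<cdot>\<^sub>m R"
    and W: "coef W 0 = 1\<^sub>m q" "\<And>i. i > m \<Longrightarrow> coef W i = 0\<^sub>m q q"
    and N: "\<And>i. i \<ge> m \<Longrightarrow> coef N i = 0\<^sub>m q q" and R: "coef R 0 = L"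
    using assms unfolding pade_remainder_def m_def[symmetric] X_def by blast
  have Q: "1\<^sub>m q - P \<in> carrier_mat q q" using projection(1) by (rule minus_carrier_mat)
  have DN: "?D * N \<in> carrier_mat q q" and DR: "?D * R \<in> carrier_mat q q" and SW: "?S * W \<in> carrier_mat q q"
    and DSW: "?D * (?S * W) \<in> carrier_mat q q" and HW: "?H * W \<in> carrier_mat q q"
    and S0W: "?K * W \<in> carrier_mat q q" and DS: "?D * ?S \<in> carrier_mat q q"
    using c by (auto intro!: mult_carrier_mat[of _ q q])
  have TDN: "?T * (?D * N) \<in> carrier_mat q q" and TDR: "?T * (?D * R) \<in> carrier_mat q q"
    and CDN: "?C * (?D * N) \<in> carrier_mat q q" and ADN: "?A * (?D * N) \<in> carrier_mat q q"
    and TDS: "?T * (?D * ?S) \<in> carrier_mat q q" and TDSW: "?T * (?D * (?S * W)) \<in> carrier_mat q q"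
    using DN DR DS DSW by (auto intro!: mult_carrier_mat[of _ q q])
  have U: "?U = b \<cdot>\<^sub>m ?S" unfolding b_def by (rule gen_fun_plus_transform[of s q \<alpha>, OF s_carrier])
  have bT: "b \<cdot>\<^sub>m ?T = ?C + X \<cdot>\<^sub>m ?A"
    unfolding b_def X_def by (rule gen_fun_shifted[of t q \<alpha>, OF t_carrier])
  have bS: "b \<cdot>\<^sub>m ?S = ?K + X \<cdot>\<^sub>m ?H"
    unfolding b_def X_def by (rule gen_fun_shifted[of s q \<alpha>, OF s_carrier])
  have e1: "b \<cdot>\<^sub>m (?T * (?D * N)) = ?C * (?D * N) + X \<cdot>\<^sub>m (?A * (?D * N))"
  proof -
    have "b \<cdot>\<^sub>m (?T * (?D * N)) = (b \<cdot>\<^sub>m ?T) * (?D * N)" using DN by (simp add: mult_smult_assoc_mat[of _ q q _ q])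
    then show ?thesis unfolding bT using DN by (simp add: prods)
  qed
  have e2: "b \<cdot>\<^sub>m (?S * W) = ?K * W + X \<cdot>\<^sub>m (?H * W)"
  proof -
    have "b \<cdot>\<^sub>m (?S * W) = (b \<cdot>\<^sub>m ?S) * W" using c by (simp add: mult_smult_assoc_mat[of _ q q _ q])
    then show ?thesis unfolding bS using c by (simp add: prods)
  qed
  have e3: "b \<cdot>\<^sub>m (?T * (?D * (?S * W))) = ?H * W"
  proof -
    have "?H * W = ?T * (?D * (b \<cdot>\<^sub>m ?S)) * W" using T_D_U unfolding U by simp
    also have "\<dots> = b \<cdot>\<^sub>m (?T * (?D * (?S * W)))" using c DS TDS SW DSW TDSW by (simp add: prods)
    finally show ?thesis by simp
  qed
  have e4: "?T * (?D * (?S * W)) = ?T * (?D * N) + X ^ (2 * m) \<cdot>\<^sub>m (?T * (?D * R))"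
    unfolding eq using c DN DR by (simp add: prods)
  define Y where "Y = b \<cdot>\<^sub>m N - ?K * W - X \<cdot>\<^sub>m (?C * (?D * N))"
  define R' where "R' = b \<cdot>\<^sub>m R - X \<cdot>\<^sub>m (b \<cdot>\<^sub>m (?T * (?D * R)))"
  have YR: "Y \<in> carrier_mat q q" "R' \<in> carrier_mat q q"
    using S0W CDN TDR by (auto simp: Y_def R'_def minus_carrier_mat)
  \<comment> \<open>\<open>Y\<close> collects the terms of degree at most \<open>m\<close> and \<open>R'\<close> the error term.\<close>
  have key: "X ^ 2 \<cdot>\<^sub>m (?A * (?D * N)) = Y + X ^ (2 * m) \<cdot>\<^sub>m R'"
  proof (rule eq_matI)
    fix i j assume "i < dim_row (Y + X ^ (2 * m) \<cdot>\<^sub>m R')" "j < dim_col (Y + X ^ (2 * m) \<cdot>\<^sub>m R')"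
    then have ij: "i < q" "j < q" using YR by auto
    define x where "x = X ^ (2 * m)"
    note dims = carrier_matD[OF TDN] carrier_matD[OF TDR] carrier_matD[OF CDN] carrier_matD[OF ADN]
      carrier_matD[OF TDSW] carrier_matD[OF SW] carrier_matD[OF S0W] carrier_matD[OF HW] carrier_matD[OF c(1)]
      carrier_matD[OF c(2)] carrier_matD[OF c(3)]
    note entry = arg_cong[of _ _ "\<lambda>M. M $$ (i, j)"]
    define tdn tdr cdn adn tdsw sw s0w hw nn rr where
      "tdn = (?T * (?D * N)) $$ (i, j)" "tdr = (?T * (?D * R)) $$ (i, j)" "cdn = (?C * (?D * N)) $$ (i, j)"
      "adn = (?A * (?D * N)) $$ (i, j)" "tdsw = (?T * (?D * (?S * W))) $$ (i, j)" "sw = (?S * W) $$ (i, j)"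
      "s0w = (?K * W) $$ (i, j)" "hw = (?H * W) $$ (i, j)" "nn = N $$ (i, j)" "rr = R $$ (i, j)"
    note defs = this
    note sm = ij dims index_smult_mat index_add_mat index_minus_mat
    have 1: "b * tdn = cdn + X * adn" using entry[OF e1] unfolding defs using sm by simp
    have 2: "b * sw = s0w + X * hw" using entry[OF e2] unfolding defs using sm by simp
    have 3: "b * tdsw = hw" using entry[OF e3] unfolding defs using sm by simp
    have 4: "tdsw = tdn + x * tdr" using entry[OF e4] unfolding defs x_def using sm by simp
    have 5: "sw = nn + x * rr" using entry[OF eq] unfolding defs x_def using sm by simp
    have "X ^ 2 * adn = X * (b * tdn) - X * cdn" unfolding 1 by (simp add: power2_eq_square algebra_simps)
    also have "b * tdn = hw - x * (b * tdr)" unfolding 3[symmetric] 4 by (simp add: algebra_simps)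
    also have "X * (hw - x * (b * tdr)) - X * cdn = X * hw - x * (X * (b * tdr)) - X * cdn"
      by (simp add: algebra_simps)
    also have "X * hw = b * (nn + x * rr) - s0w" unfolding 5[symmetric] 2 by simp
    finally have "X ^ 2 * adn = (b * nn - s0w - X * cdn) + x * (b * rr - X * (b * tdr))"
      by (simp add: algebra_simps)
    then show "(X ^ 2 \<cdot>\<^sub>m (?A * (?D * N))) $$ (i, j) = (Y + X ^ (2 * m) \<cdot>\<^sub>m R') $$ (i, j)"
      unfolding Y_def R'_def defs x_def using sm by simp
  qed (use ADN YR in auto)
  define W' where "W' = ?D * N + ?Q"
  have W': "W' \<in> carrier_mat q q" using DN by (simp add: W'_def)
  have AW: "?A * W' = ?A * (?D * N)"
  proof -
    have "?A * W' = ?A * (?D * N) + ?A * ?Q"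
      unfolding W'_def using DN by (intro mult_add_distrib_mat) auto
    also have "?A * ?Q = 0\<^sub>m q q" by (rule gen_fun_mult_complement[OF shifted_t_carrier shifted_t_P])
    finally show ?thesis using right_add_zero_mat[OF ADN] by simp
  qed
  have Y0: "coef Y i = 0\<^sub>m q q" if "i > m" for i
  proof -
    have 1: "coef (b \<cdot>\<^sub>m N) i = 0\<^sub>m q q"
      unfolding b_def using that N[of i] N[of "i - 1"] by (subst coef_X_poly_smult[OF c(2)]) (auto intro!: eq_matI)
    have 2: "coef (?K * W) i = 0\<^sub>m q q"
      using that W(2)[of i] c s_carrier[of 0] right_mult_zero_mat[OF s_carrier[of 0]] by (simp add: coef_gen_const_mult)
    have 3: "coef (X \<cdot>\<^sub>m (?C * (?D * N))) i = 0\<^sub>m q q"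
      unfolding X_def coef_X_smult[OF CDN]
      using that N[of "i - 1"] c DN t_carrier[of 0] pinv_s0(1) right_mult_zero_mat[OF t_carrier[of 0]] right_mult_zero_mat[OF pinv_s0(1)]
      by (simp add: coef_gen_const_mult)
    show ?thesis unfolding Y_def using c S0W CDN
      by (simp add: coef_minus[of _ q] minus_carrier_mat minus_r_inv_mat[of _ q q] 1 2 3)
  qed
  have A_coef: "coef (?A * W') i = coef Y (i + 2) + (if i < 2 * n then 0\<^sub>m q q else coef R' (i - 2 * n))" for i
  proof -
    have "coef (?A * W') i = coef (X ^ 2 \<cdot>\<^sub>m (?A * (?D * N))) (i + 2)"
      unfolding AW X_def using ADN by (simp add: coef_X_power_smult[of _ q])
    also have "\<dots> = coef Y (i + 2) + coef (X ^ (2 * m) \<cdot>\<^sub>m R') (i + 2)"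
      unfolding key using YR by (intro coef_add) auto
    finally show ?thesis unfolding X_def coef_X_power_smult[OF YR(2)] by (simp add: m_def)
  qed
  have "coef W' 0 = 1\<^sub>m q"
  proof -
    have "coef (?S * W) 0 = s 0"
    proof -
      have "{..0::nat} = insert 0 {}" by auto
      then have "coef (?S * W) 0 = msum q (\<lambda>i. coef ?S (0 - i) * coef W i) (insert 0 {})"
        using coef_mult[OF gen_fun_carrier c(1), of s 0] by simp
      also have "\<dots> = s 0 + msum q (\<lambda>i. coef ?S (0 - i) * coef W i) {}"
        using s_carrier W(1) right_mult_one_mat[OF s_carrier[of 0]] by (subst msum_insert) auto
      also have "msum q (\<lambda>i. coef ?S (0 - i) * coef W i) {} = 0\<^sub>m q q" by (rule msum_zero) simp
      finally show ?thesis using right_add_zero_mat[OF s_carrier] by simp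
    qed
    moreover have "coef (?S * W) 0 = coef N 0"
    proof -
      have "0 < 2 * m" by (simp add: m_def)
      then show ?thesis
        unfolding eq X_def using c by (simp add: coef_add[of _ q] coef_X_power_smult[of _ q])
    qed
    ultimately have "coef W' 0 = P + (1\<^sub>m q - P)"
      unfolding W'_def using c DN Q pinv_s0(1,3) by (simp add: coef_add[of _ q] coef_gen_const_mult coef_gen_const)
    then show ?thesis using add_minus_cancel_mat[OF projection(1) one_carrier_mat] by simp
  qed
  moreover have "\<forall>i>n. coef W' i = 0\<^sub>m q q"
    unfolding W'_def using c DN Q pinv_s0(1) N right_mult_zero_mat[OF pinv_s0(1)]
    by (auto simp: coef_add[of _ q] coef_gen_const_mult coef_gen_const m_def)
  moreover have "\<forall>j<n. coef (?A * W') (n + j) = 0\<^sub>m q q"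
    by (simp add: A_coef Y0 m_def)
  moreover have "coef (?A * W') (2 * n) = L"
  proof -
    have "coef R' 0 = L"
      unfolding R'_def X_def b_def using c(3) TDR R
      by (intro eq_matI) (auto simp: simp del: index_mult_mat(1))
    moreover have "L \<in> carrier_mat q q" using R c(3) by auto
    ultimately show ?thesis by (simp add: A_coef Y0 m_def)
  qed
  ultimately show ?thesis unfolding pade_remainder_iff_coef using W' by blast
qed

end

section \<open>Parameters of iterated Schur transforms\<close>

lemma block_hankel_cong:
  assumes "\<And>j. j \<le> 2 * n \<Longrightarrow> h j = h' j"
  shows "block_hankel q h n = block_hankel q h' n"
  unfolding block_hankel_def using assms by (intro block_mat_cong) auto

lemma schur_L_cong:
  assumes "\<And>j. j \<le> 2 * n \<Longrightarrow> h j = h' j"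
  shows "schur_L q h n = schur_L q h' n"
proof (cases n)
  case (Suc k)
  have "block_hankel q h k = block_hankel q h' k"
    "block_mat q 1 (Suc k) (\<lambda>_ j. h (Suc k + j)) = block_mat q 1 (Suc k) (\<lambda>_ j. h' (Suc k + j))"
    "block_mat q (Suc k) 1 (\<lambda>j _. h (Suc k + j)) = block_mat q (Suc k) 1 (\<lambda>j _. h' (Suc k + j))"
    using assms Suc by (auto intro!: block_hankel_cong block_mat_cong)
  then show ?thesis using assms[of "2 * n"] by (simp add: Suc schur_L_Suc)
qed (use assms in \<open>simp add: schur_L_def\<close>)

text \<open>The last entry enters the Schur complement only as its minuend.\<close>

lemma schur_L_change_last:
  assumes "\<And>j. j < 2 * n \<Longrightarrow> h' j = h j" and h: "h (2 * n) \<in> carrier_mat q q" "h' (2 * n) \<in> carrier_mat q q"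
  shows "schur_L q h' n = schur_L q h n - (h (2 * n) - h' (2 * n))"
proof (cases n)
  case 0
  then show ?thesis using h by (auto simp: schur_L_def intro!: eq_matI)
next
  case (Suc k)
  define X where "X = block_mat q 1 (Suc k) (\<lambda>_ j. h (Suc k + j)) * pinv (block_hankel q h k) *
     block_mat q (Suc k) 1 (\<lambda>j _. h (Suc k + j))"
  have "block_hankel q h' k = block_hankel q h k"
    "block_mat q 1 (Suc k) (\<lambda>_ j. h' (Suc k + j)) = block_mat q 1 (Suc k) (\<lambda>_ j. h (Suc k + j))"
    "block_mat q (Suc k) 1 (\<lambda>j _. h' (Suc k + j)) = block_mat q (Suc k) 1 (\<lambda>j _. h (Suc k + j))"
    using assms(1) Suc by (auto intro!: block_hankel_cong block_mat_cong)
  then have "schur_L q h' n = h' (2 * n) - X" "schur_L q h n = h (2 * n) - X"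
    by (simp_all add: Suc schur_L_Suc X_def)
  moreover have "dim_row X = q" "dim_col X = q" by (simp_all add: X_def)
  ultimately show ?thesis using h by (auto intro!: eq_matI)
qed

lemma stieltjes_param_cong:
  assumes "\<And>i. i \<le> j \<Longrightarrow> s i = s' i"
  shows "stieltjes_param q \<alpha> s j = stieltjes_param q \<alpha> s' j"
proof (cases "even j")
  case True
  then show ?thesis unfolding stieltjes_param_def using assms by (auto intro!: schur_L_cong)
next
  case False
  then have "2 * (j div 2) + 1 = j" by presburger
  then have "schur_L q (shifted \<alpha> s) (j div 2) = schur_L q (shifted \<alpha> s') (j div 2)"
    using assms by (intro schur_L_cong) (auto simp: shifted_def)
  then show ?thesis using False by (simp add: stieltjes_param_def)
qed

lemma stieltjes_class_iff:
  "s \<in> stieltjes_class q m \<alpha> \<longleftrightarrow> (\<forall>j\<le>m. s j \<in> carrier_mat q q) \<and>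
    nonneg_hermitian (block_hankel q s (m div 2)) \<and>
    (0 < m \<longrightarrow> nonneg_hermitian (block_hankel q (shifted \<alpha> s) ((m - 1) div 2)))"
proof (cases "m = 0")
  case True
  then show ?thesis by (auto simp: stieltjes_class_def block_hankel_0)
next
  case False
  have "(m - 1) div 2 = (if even m then m div 2 - 1 else m div 2)" using False by (cases m) auto
  then show ?thesis using False by (auto simp: stieltjes_class_def)
qed

lemma stieltjes_class_cong:
  assumes "\<And>j. j \<le> m \<Longrightarrow> s j = s' j"
  shows "s \<in> stieltjes_class q m \<alpha> \<longleftrightarrow> s' \<in> stieltjes_class q m \<alpha>"
proof -
  have "block_hankel q s (m div 2) = block_hankel q s' (m div 2)"
    using assms by (intro block_hankel_cong) auto
  moreover have "block_hankel q (shifted \<alpha> s) ((m - 1) div 2) = block_hankel q (shifted \<alpha> s') ((m - 1) div 2)" if "0 < m"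
    using assms that by (intro block_hankel_cong) (auto simp: shifted_def)
  ultimately show ?thesis using assms by (auto simp: stieltjes_class_iff)
qed

lemma plus_transform_cong:
  assumes "\<And>i. i \<le> j \<Longrightarrow> s i = s' i"
  shows "plus_transform q \<alpha> s j = plus_transform q \<alpha> s' j"
  using assms by (simp add: plus_transform_def)

lemma reciprocal_cong:
  assumes "\<And>i. i \<le> j \<Longrightarrow> u i = u' i"
  shows "reciprocal q u j = reciprocal q u' j"
  using assms
proof (induction j rule: less_induct)
  case (less j)
  have "msum q (\<lambda>l. u (j - l) * reciprocal q u l) {..<j} = msum q (\<lambda>l. u' (j - l) * reciprocal q u' l) {..<j}"
    using less by (intro msum_eqI) auto
  then show ?case using less.prems[of 0] by (subst (1 2) reciprocal.simps) simp
qed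

lemma schur_transform1_cong:
  assumes "\<And>i. i \<le> Suc j \<Longrightarrow> s i = s' i"
  shows "schur_transform1 q \<alpha> s j = schur_transform1 q \<alpha> s' j"
proof -
  have "reciprocal q (plus_transform q \<alpha> s) (j + 1) = reciprocal q (plus_transform q \<alpha> s') (j + 1)"
    using assms by (intro reciprocal_cong plus_transform_cong) auto
  then show ?thesis using assms[of 0] by (simp add: schur_transform1_def)
qed

lemma msum_single:
  assumes "finite I" "a \<in> I" "f a \<in> carrier_mat q q" "\<And>r. r \<in> I \<Longrightarrow> r \<noteq> a \<Longrightarrow> f r = 0\<^sub>m q q"
  shows "msum q f I = f a"
proof -
  have "msum q f I = msum q f (insert a (I - {a}))" using assms(2) by (simp add: insert_absorb)
  also have "\<dots> = f a + msum q f (I - {a})" using assms by (intro msum_insert) auto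
  also have "msum q f (I - {a}) = 0\<^sub>m q q" using assms by (intro msum_zero) auto
  finally show ?thesis using assms by simp
qed

text \<open>This is congruence with the block diagonal matrix whose diagonal blocks are \<open>M\<close>.\<close>

lemma block_hankel_congruence_nonneg:
  assumes h: "\<And>j. h j \<in> carrier_mat q q" and M: "M \<in> carrier_mat q q"
    and nn: "nonneg_hermitian (block_hankel q h n)"
  shows "nonneg_hermitian (block_hankel q (\<lambda>j. mat_adjoint M * h j * M) n)"
proof -
  define N where "N = n + 1"
  define Z where "Z = (0\<^sub>m q q :: complex mat)"
  define E where "E = block_mat q N N (\<lambda>j k. if j = k then M else Z)"
  define F where "F = block_mat q N N (\<lambda>j k. mat_adjoint M * h (j + k))"
  note M' = adjoint_carrier[OF M]
  have Z: "Z \<in> carrier_mat q q" by (simp add: Z_def)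
  have Ea: "mat_adjoint E = block_mat q N N (\<lambda>j k. if j = k then mat_adjoint M else Z)"
    unfolding E_def using M Z by (subst block_mat_adjoint) (auto simp: Z_def intro!: block_mat_cong)
  have Mh: "mat_adjoint M * h j \<in> carrier_mat q q" for j using M' h by (rule mult_carrier_mat)
  have EH: "mat_adjoint E * block_hankel q h n = F"
    unfolding Ea block_hankel_def F_def N_def[symmetric]
  proof (subst block_mat_mult)
    show "block_mat q N N (\<lambda>j l. msum q (\<lambda>k. (if j = k then mat_adjoint M else Z) * h (k + l)) {..<N}) =
      block_mat q N N (\<lambda>j k. mat_adjoint M * h (j + k))"
    proof (rule block_mat_cong)
      fix j l assume "j < N" "l < N"
      then show "msum q (\<lambda>k. (if j = k then mat_adjoint M else Z) * h (k + l)) {..<N} = mat_adjoint M * h (j + l)"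
        using Mh left_mult_zero_mat[OF h] by (subst msum_single[of _ j]) (auto simp: Z_def)
    qed
  qed (use M' Z h in auto)
  have "F * E = block_hankel q (\<lambda>j. mat_adjoint M * h j * M) n"
    unfolding E_def block_hankel_def F_def N_def[symmetric]
  proof (subst block_mat_mult)
    show "block_mat q N N (\<lambda>j l. msum q (\<lambda>k. mat_adjoint M * h (j + k) * (if k = l then M else Z)) {..<N}) =
      block_mat q N N (\<lambda>j k. mat_adjoint M * h (j + k) * M)"
    proof (rule block_mat_cong)
      fix j l assume "j < N" "l < N"
      then show "msum q (\<lambda>k. mat_adjoint M * h (j + k) * (if k = l then M else Z)) {..<N} = mat_adjoint M * h (j + l) * M"
        using mult_carrier_mat[OF Mh M] right_mult_zero_mat[OF Mh] by (subst msum_single[of _ l]) (auto simp: Z_def)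
    qed
  qed (use M Z Mh in auto)
  then have "block_hankel q (\<lambda>j. mat_adjoint M * h j * M) n = mat_adjoint E * block_hankel q h n * E"
    by (simp add: EH)
  moreover have "E \<in> carrier_mat (N * q) (N * q)" by (simp add: E_def)
  moreover have "block_hankel q h n \<in> carrier_mat (N * q) (N * q)"
    using block_hankel_carrier[of q h n] by (simp add: N_def)
  ultimately show ?thesis using nonneg_hermitian_congruence[OF _ _ nn] by metis
qed

text \<open>The Pade equations express each \<open>h j\<close> with \<open>0 < j < 2 n\<close> as a combination of earlier entries with
  coefficients on the right, and such combinations inherit \<open>M * h j = h j\<close>.\<close>

lemma hankel_range:
  assumes h: "\<And>j. h j \<in> carrier_mat q q" and M: "M \<in> carrier_mat q q" "M * h 0 = h 0"
    and nn: "nonneg_hermitian (block_hankel q h n)" and j: "j < 2 * n"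
  shows "M * h j = h j"
  using j
proof (induction j rule: less_induct)
  case (less j)
  show ?case
  proof (cases "j = 0")
    case False
    \<comment> \<open>The Pade equations of order \<open>i\<close> have indices \<open>i, ..., 2 * i - 1\<close>; this is the least order that reaches \<open>j\<close>.\<close>
    define i where "i = j div 2 + 1"
    define l where "l = j - i"
    have i: "i \<le> n" "l < i" "j = i + l" using less.prems False by (auto simp: i_def l_def)
    have herm: "mat_adjoint (h j) = h j" if "j < 2 * n" for j
      using block_hankel_hermitian_entries[of h q n j, OF h] nn that by (simp add: nonneg_hermitian_def)
    obtain L where "pade_remainder q h i L"
      using hankel_nonneg_iff[of h q n, OF h herm] nn i(1) by blast
    then obtain W where W: "W \<in> carrier_mat q q" "coef W 0 = 1\<^sub>m q" "\<forall>k>i. coef W k = 0\<^sub>m q q"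
      and z: "\<forall>l<i. coef (gen_fun q h * W) (i + l) = 0\<^sub>m q q"
      unfolding pade_remainder_iff_coef by blast
    define X where "X = msum q (\<lambda>k. h (l + k) * coef W (i - k)) {..<i}"
    have X: "X \<in> carrier_mat q q" by (simp add: X_def)
    have hW: "h a * coef W b \<in> carrier_mat q q" for a b
      using h coef_carrier[OF W(1)] by (rule mult_carrier_mat)
    have "h (i + l) + X = 0\<^sub>m q q"
      using coef_monic_mult[of h q W i l, OF h W] z i(2) by (simp add: X_def)
    then have hj: "h j = - X"
      using h[of "i + l"] X minus_zero_imp_eq_mat[of "h (i + l)" q q "- X"] i(3)
      by (simp add: minus_add_uminus_mat[of _ q q] )
    have "M * X = X"
      unfolding X_def msum_mult_left[OF M(1) hW]
    proof (rule msum_eqI)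
      fix k assume "k \<in> {..<i}"
      then have "M * h (l + k) = h (l + k)" using less.IH[of "l + k"] less.prems i by auto
      then show "M * (h (l + k) * coef W (i - k)) = h (l + k) * coef W (i - k)"
        using assoc_mult_mat[OF M(1) h coef_carrier[OF W(1)], of "l + k" "i - k"] by simp
    qed
    then show ?thesis unfolding hj using carrier_matD[OF M(1)] carrier_matD[OF X] by (simp add: uminus_mult_right_mat)
  qed (use M in simp)
qed

context corner_sequence
begin

text \<open>Pade remainders pass from the shifted sequence to \<open>t\<close>, and with them positivity and Schur complements.\<close>

lemma schur_L_transform:
  assumes nn: "nonneg_hermitian (block_hankel q (shifted \<alpha> s) n)"
  shows "nonneg_hermitian (block_hankel q t n)"
    and "i \<le> n \<Longrightarrow> schur_L q t i = schur_L q (shifted \<alpha> s) i"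
proof -
  have sh: "mat_adjoint (shifted \<alpha> s j) = shifted \<alpha> s j" for j
    unfolding shifted_def using s_hermitian s_carrier by (simp add: adjoint_add[of _ q q] adjoint_smult)
  have p: "\<exists>L. pade_remainder q (shifted \<alpha> s) i L \<and> nonneg_hermitian L" if "i \<le> n" for i
    using hankel_nonneg_iff[of "shifted \<alpha> s" q n, OF shifted_carrier sh] nn that by blast
  show nt: "nonneg_hermitian (block_hankel q t n)"
    unfolding hankel_nonneg_iff[of t q n, OF t_carrier t_hermitian] using p pade_remainder_transform by blast
  assume i: "i \<le> n"
  then obtain L where L: "pade_remainder q (shifted \<alpha> s) i L" using p by blast
  show "schur_L q t i = schur_L q (shifted \<alpha> s) i"
    using schur_L_eq_pade_remainder[of "shifted \<alpha> s" q n i L, OF shifted_carrier nn i L]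
      schur_L_eq_pade_remainder[of t q n i L, OF t_carrier nt i pade_remainder_transform[OF L]] by simp
qed

lemma schur_L_shifted_transform:
  assumes nn: "nonneg_hermitian (block_hankel q s (Suc n))"
  shows "nonneg_hermitian (block_hankel q (shifted \<alpha> t) n)"
    and "i \<le> n \<Longrightarrow> schur_L q (shifted \<alpha> t) i = schur_L q s (Suc i)"
proof -
  have th: "mat_adjoint (shifted \<alpha> t j) = shifted \<alpha> t j" for j
    unfolding shifted_def using t_hermitian t_carrier by (simp add: adjoint_add[of _ q q] adjoint_smult)
  have p: "\<exists>L. pade_remainder q s (Suc i) L \<and> nonneg_hermitian L" if "i \<le> n" for i
    using hankel_nonneg_iff[of s q "Suc n", OF s_carrier s_hermitian] nn that by (meson Suc_le_mono)
  show nt: "nonneg_hermitian (block_hankel q (shifted \<alpha> t) n)"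
    unfolding hankel_nonneg_iff[of "shifted \<alpha> t" q n, OF shifted_t_carrier th]
    using p pade_remainder_shifted_transform by blast
  assume i: "i \<le> n"
  then obtain L where L: "pade_remainder q s (Suc i) L" using p by blast
  have i': "Suc i \<le> Suc n" using i by simp
  show "schur_L q (shifted \<alpha> t) i = schur_L q s (Suc i)"
    using schur_L_eq_pade_remainder[of s q "Suc n" "Suc i" L, OF s_carrier nn i' L]
      schur_L_eq_pade_remainder[of "shifted \<alpha> t" q n i L, OF shifted_t_carrier nt i pade_remainder_shifted_transform[OF L]]
    by simp
qed

lemma corner_step:
  assumes m: "s \<in> stieltjes_class q (Suc m) \<alpha>"
  shows "t \<in> stieltjes_class q m \<alpha>"
    and "j \<le> m \<Longrightarrow> stieltjes_param q \<alpha> t j = stieltjes_param q \<alpha> s (Suc j)"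
proof -
  have a: "nonneg_hermitian (block_hankel q (shifted \<alpha> s) (m div 2))"
    and b: "nonneg_hermitian (block_hankel q s (Suc m div 2))"
    using m by (auto simp: stieltjes_class_iff)
  have c: "nonneg_hermitian (block_hankel q s (Suc ((m - 1) div 2)))" if "0 < m"
  proof -
    have "Suc m div 2 = Suc ((m - 1) div 2)" using that by (cases m) auto
    then show ?thesis using b by simp
  qed
  show "t \<in> stieltjes_class q m \<alpha>"
    using schur_L_transform(1)[OF a] schur_L_shifted_transform(1)[OF c] t_carrier by (auto simp: stieltjes_class_iff)
  assume j: "j \<le> m"
  show "stieltjes_param q \<alpha> t j = stieltjes_param q \<alpha> s (Suc j)"
  proof (cases "even j")
    case True
    then show ?thesis using schur_L_transform(2)[OF a, of "j div 2"] j by (auto simp: stieltjes_param_def div_le_mono)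
  next
    case False
    then have "0 < m" using j by (cases m) auto
    moreover have "j div 2 \<le> (m - 1) div 2" using j False by presburger
    ultimately have "schur_L q (shifted \<alpha> t) (j div 2) = schur_L q s (Suc (j div 2))"
      using schur_L_shifted_transform(2)[OF c, of "j div 2"] by simp
    moreover have "Suc j div 2 = Suc (j div 2)" using False by presburger
    ultimately show ?thesis using False by (simp add: stieltjes_param_def)
  qed
qed

end

text \<open>Compress the last entry: \<open>y j = P * s j * P\<close> agrees with \<open>s j\<close> for \<open>j \<le> m\<close> and belongs to the class by
  congruence, so \<open>corner_step\<close> applies to it. Its Schur transform agrees with that of \<open>s\<close> because the
  last entry is used only between two factors \<open>pinv (s 0)\<close>, which absorb \<open>P\<close>.\<close>

lemma schur_step:
  assumes s: "s \<in> stieltjes_class q (Suc m) \<alpha>"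
  defines "t \<equiv> schur_transform1 q \<alpha> s"
  shows "t \<in> stieltjes_class q m \<alpha>"
    and "j < m \<Longrightarrow> stieltjes_param q \<alpha> t j = stieltjes_param q \<alpha> s (Suc j)"
    and "stieltjes_param q \<alpha> t m = stieltjes_param q \<alpha> s (Suc m) -
      (s (Suc m) - s 0 * pinv (s 0) * s (Suc m) * pinv (s 0) * s 0)"
proof -
  define M where "M = Suc m"
  \<comment> \<open>Entries beyond the last index are arbitrary in \<open>s\<close>; zeros make all entries Hermitian.\<close>
  define x where "x j = (if j \<le> M then s j else 0\<^sub>m q q)" for j
  have xc: "x j \<in> carrier_mat q q" for j using s by (auto simp: x_def M_def stieltjes_class_iff)
  have xs: "x j = s j" if "j \<le> M" for j using that by (simp add: x_def)
  have x: "x \<in> stieltjes_class q M \<alpha>"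
    using s stieltjes_class_cong[of M x s q \<alpha>] xs by (simp add: M_def)
  have xac: "shifted \<alpha> x j \<in> carrier_mat q q" for j using xc by (simp add: shifted_def)
  have nn: "nonneg_hermitian (block_hankel q x (M div 2))"
    and nna: "nonneg_hermitian (block_hankel q (shifted \<alpha> x) (m div 2))"
    using x by (auto simp: stieltjes_class_iff M_def)
  have xa: "x (Suc j) = shifted \<alpha> x j + complex_of_real \<alpha> \<cdot>\<^sub>m x j" for j
    using xc[of j] xc[of "Suc j"] by (intro eq_matI) (auto simp: shifted_def)
  have xh: "mat_adjoint (x j) = x j" for j
  proof -
    have "2 * (M div 2) = (if even M then M else M - 1)" by (cases "even M") auto
    then consider "j \<le> 2 * (M div 2)" | "j = M" "odd M" | "M < j"
      by (cases "even M"; cases "j < M"; cases "j = M") auto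
    then show ?thesis
    proof cases
      case 1
      then show ?thesis
        using block_hankel_hermitian_entries[of x q "M div 2" j, OF xc] nn by (simp add: nonneg_hermitian_def)
    next
      case 2
      then have m: "2 * (m div 2) = m" "2 * (M div 2) = m" by (auto simp: M_def)
      have "mat_adjoint (shifted \<alpha> x m) = shifted \<alpha> x m"
        using block_hankel_hermitian_entries[of "shifted \<alpha> x" q "m div 2" m, OF xac] nna m by (simp add: nonneg_hermitian_def)
      moreover have "mat_adjoint (x m) = x m"
        using block_hankel_hermitian_entries[of x q "M div 2" m, OF xc] nn m by (simp add: nonneg_hermitian_def)
      ultimately show ?thesis
        unfolding 2(1) M_def xa using xac xc by (simp add: adjoint_add[of _ q q] adjoint_smult)
    next
      case 3
      then show ?thesis by (simp add: x_def)
    qed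
  qed
  have x0: "nonneg_hermitian (x 0)"
  proof -
    have herm: "mat_adjoint (x j) = x j" for j by (rule xh)
    have "nonneg_hermitian (block_hankel q x 0)"
      using nn hankel_nonneg_iff[of x q "M div 2", OF xc herm] hankel_nonneg_iff[of x q 0, OF xc herm] by simp
    then show ?thesis using xc by (simp add: block_hankel_0)
  qed
  define d where "d = pinv (x 0)"
  define P where "P = x 0 * d"
  have d: "d \<in> carrier_mat q q" "mat_adjoint d = d" "P = d * x 0" "P * x 0 = x 0" "P * d = d"
    using moore_penrose_nonneg_hermitian[OF xc[of 0] x0] by (auto simp: P_def d_def)
  have P: "P \<in> carrier_mat q q" unfolding P_def using xc[of 0] d(1) by (rule mult_carrier_mat)
  have Ph: "mat_adjoint P = P"
    unfolding P_def using adjoint_mult[OF xc[of 0] d(1)] d(2,3) xh[of 0] by (simp add: P_def)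
  have PP: "P * P = P"
    using assoc_mult_mat[OF P xc[of 0] d(1)] d(4) by (simp add: P_def)
  have dP: "d * P = d" using arg_cong[OF d(5), of mat_adjoint] adjoint_mult[OF P d(1)] Ph d(2) by simp
  have Px: "P * x j = x j" if j: "j < M" for j
  proof -
    have low: "P * x j = x j" if "j < 2 * (M div 2)" for j
      by (rule hankel_range[of x q P "M div 2", OF xc P d(4) nn that])
    show ?thesis
    proof (cases "j < 2 * (M div 2) \<or> j = 0")
      case True
      then show ?thesis using low d(4) by auto
    next
      case False
      then have jm: "j = m" "even m" "m > 0" using j unfolding M_def by presburger+
      \<comment> \<open>The range condition for \<open>x\<close> stops before \<open>x m\<close>; the one for the shifted sequence reaches it.\<close>
      define k where "k = m - 1"
      have k: "m = Suc k" "k < 2 * (m div 2)" "1 < 2 * (M div 2)" "k < 2 * (M div 2)" "0 < 2 * (M div 2)"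
        using jm by (auto simp: k_def M_def)
      have "P * shifted \<alpha> x 0 = shifted \<alpha> x 0"
        using low[OF k(3)] low[OF k(5)] mult_add_distrib_mat[OF P, of "(- complex_of_real \<alpha>) \<cdot>\<^sub>m x 0" q "x 1"]
          mult_smult_distrib[OF P xc[of 0]] xc by (simp add: shifted_def)
      then have "P * shifted \<alpha> x k = shifted \<alpha> x k"
        by (rule hankel_range[of "shifted \<alpha> x" q P "m div 2", OF xac P _ nna k(2)])
      then show ?thesis
        unfolding jm(1) k(1) xa
        using low[OF k(4)] mult_add_distrib_mat[OF P xac[of k], of "complex_of_real \<alpha> \<cdot>\<^sub>m x k"]
          mult_smult_distrib[OF P xc[of k]] xc by simp
    qed
  qed
  have xP: "x j * P = x j" if "j < M" for j
    using arg_cong[OF Px[OF that], of mat_adjoint] adjoint_mult[OF P xc[of j]] Ph xh[of j] by simp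
  define y where "y j = P * x j * P" for j
  have yc: "y j \<in> carrier_mat q q" for j
    unfolding y_def using P xc[of j] by (auto intro!: mult_carrier_mat[of _ q q])
  have yx: "y j = x j" if "j < M" for j using Px[OF that] xP[OF that] by (simp add: y_def)
  have yh: "mat_adjoint (y j) = y j" for j
    unfolding y_def using adjoint_mult[OF mult_carrier_mat[OF P xc[of j]] P] adjoint_mult[OF P xc[of j]] xh[of j] Ph
      assoc_mult_mat[OF P xc[of j] P] by simp
  have y0: "y 0 = x 0" using yx[of 0] by (simp add: M_def)
  have ys: "shifted \<alpha> y j = P * shifted \<alpha> x j * P" for j
    unfolding y_def shifted_def using P xc mult_carrier_mat[OF P xc]
    by (simp add: mult_add_distrib_mat[of _ q q _ q] add_mult_distrib_mat[of _ q q _ _ q]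
        mult_smult_distrib[of _ q q _ q] mult_smult_assoc_mat[of _ q q _ q])
  have y: "y \<in> stieltjes_class q M \<alpha>"
  proof -
    have y_fun: "y = (\<lambda>j. P * x j * P)" by (simp add: fun_eq_iff y_def)
    have ya_fun: "shifted \<alpha> y = (\<lambda>j. P * shifted \<alpha> x j * P)" by (simp add: fun_eq_iff ys)
    have "nonneg_hermitian (block_hankel q y (M div 2))"
      using block_hankel_congruence_nonneg[of x q P, OF xc P nn] by (simp add: Ph y_fun)
    moreover have "nonneg_hermitian (block_hankel q (shifted \<alpha> y) (m div 2))"
      using block_hankel_congruence_nonneg[of "shifted \<alpha> x" q P, OF xac P nna]
      by (simp add: Ph ya_fun)
    ultimately show ?thesis using yc by (simp add: stieltjes_class_iff M_def)
  qed
  interpret corner_sequence q \<alpha> y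
  proof
    show "y 0 * pinv (y 0) * y j = y j" for j
      unfolding y0 d_def[symmetric] P_def[symmetric] unfolding y_def
      using assoc_mult_mat[OF P P xc[of j]] assoc_mult_mat[OF P mult_carrier_mat[OF P xc[of j]] P] PP by simp
  qed (use yc yh x0 y0 in auto)
  have ty: "schur_transform1 q \<alpha> y j = t j" if j: "j \<le> m" for j
  proof (cases "j < m")
    case True
    then show ?thesis unfolding t_def using yx xs by (intro schur_transform1_cong) (auto simp: M_def)
  next
    case False
    then have jm: "j = m" using j by simp
    define u v where "u = plus_transform q \<alpha> x" and "v = plus_transform q \<alpha> y"
    have uc: "u j \<in> carrier_mat q q" "v j \<in> carrier_mat q q" for j
      using xc yc by (simp_all add: u_def v_def plus_transform_def)
    have uv: "v j = u j" if "j < M" for j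
      unfolding u_def v_def using yx that by (intro plus_transform_cong) auto
    have r: "reciprocal q v j = reciprocal q u j" if "j < M" for j
      using uv that by (intro reciprocal_cong) auto
    have u0: "u 0 = x 0" "v 0 = x 0" using xc[of 0] yc[of 0] y0 by (simp_all add: u_def v_def plus_transform_def)
    have rc: "reciprocal q u j \<in> carrier_mat q q" for j
      using d(1) by (subst reciprocal.simps) (auto simp: u0 d_def[symmetric] intro!: mult_carrier_mat[of _ q q])
    have vM: "v M = P * u M * P"
    proof -
      have "u M = shifted \<alpha> x m" "v M = shifted \<alpha> y m"
        by (simp_all add: u_def v_def plus_transform_def shifted_def M_def)
      then show ?thesis using ys by simp
    qed
    have eq: "d * (v (M - l) * reciprocal q v l) = d * (u (M - l) * reciprocal q u l)" if l: "l < M" for l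
    proof (cases "l = 0")
      case True
      have "reciprocal q u 0 = d" "reciprocal q v 0 = d"
        by (subst reciprocal.simps, simp add: u0 d_def)+
      moreover have "d * (P * u M * P * d) = d * (u M * d)"
      proof -
        have c: "u M * d \<in> carrier_mat q q" "P * u M \<in> carrier_mat q q"
          using uc P d(1) by (auto intro!: mult_carrier_mat[of _ q q])
        have "P * u M * P * d = P * (u M * d)"
          using assoc_mult_mat[OF c(2) P d(1)] assoc_mult_mat[OF P uc(1) d(1), of M] d(5) by simp
        then show ?thesis using assoc_mult_mat[OF d(1) P c(1)] dP by simp
      qed
      ultimately show ?thesis using True vM by simp
    next
      case False
      then show ?thesis using uv[of "M - l"] r[OF l] l by simp
    qed
    have "d * msum q (\<lambda>l. v (M - l) * reciprocal q v l) {..<M} = d * msum q (\<lambda>l. u (M - l) * reciprocal q u l) {..<M}"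
    proof -
      have "d * msum q (\<lambda>l. v (M - l) * reciprocal q v l) {..<M} = msum q (\<lambda>l. d * (v (M - l) * reciprocal q v l)) {..<M}"
        using uc rc r d(1) by (intro msum_mult_left) (auto intro!: mult_carrier_mat[of _ q q])
      also have "\<dots> = msum q (\<lambda>l. d * (u (M - l) * reciprocal q u l)) {..<M}"
        by (rule msum_eqI) (simp add: eq)
      also have "\<dots> = d * msum q (\<lambda>l. u (M - l) * reciprocal q u l) {..<M}"
        using uc rc d(1) by (intro msum_mult_left[symmetric]) (auto intro!: mult_carrier_mat[of _ q q])
      finally show ?thesis .
    qed
    then have "reciprocal q v M = reciprocal q u M"
      by (subst (1 2) reciprocal.simps) (simp add: u0 d_def M_def)
    then have "schur_transform1 q \<alpha> y m = schur_transform1 q \<alpha> x m"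
      by (simp add: schur_transform1_def u_def v_def M_def y0)
    also have "\<dots> = t m" unfolding t_def using xs by (intro schur_transform1_cong) (auto simp: M_def)
    finally show ?thesis by (simp add: jm)
  qed
  have tp: "stieltjes_param q \<alpha> t j = stieltjes_param q \<alpha> y (Suc j)" if "j \<le> m" for j
    using corner_step(2)[of m j] y that stieltjes_param_cong[of j "schur_transform1 q \<alpha> y" t q \<alpha>] ty
    by (simp add: M_def)
  show "t \<in> stieltjes_class q m \<alpha>"
    using corner_step(1)[of m] y stieltjes_class_cong[of m "schur_transform1 q \<alpha> y" t q \<alpha>] ty by (simp add: M_def)
  show "stieltjes_param q \<alpha> t j = stieltjes_param q \<alpha> s (Suc j)" if "j < m"
    using tp[of j] that stieltjes_param_cong[of "Suc j" y s q \<alpha>] yx xs by (simp add: M_def)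
  have sM: "s M = x M" "s 0 = x 0" by (simp_all add: x_def)
  have defect: "s 0 * pinv (s 0) * s M * pinv (s 0) * s 0 = y M"
    unfolding sM d_def[symmetric] P_def[symmetric] y_def
    using assoc_mult_mat[OF mult_carrier_mat[OF P xc[of M]] d(1) xc[of 0]] d(3) by simp
  have "stieltjes_param q \<alpha> y M = stieltjes_param q \<alpha> x M - (x M - y M)"
  proof (cases "even M")
    case True
    then have "2 * (M div 2) = M" by simp
    then show ?thesis
      using True schur_L_change_last[of "M div 2" y x q] yx xc yc by (simp add: stieltjes_param_def)
  next
    case False
    then have e: "2 * (M div 2) = m" by (simp add: M_def)
    have "shifted \<alpha> y j = shifted \<alpha> x j" if "j < m" for j
      using that yx by (simp add: shifted_def M_def)
    then have "schur_L q (shifted \<alpha> y) (M div 2) = schur_L q (shifted \<alpha> x) (M div 2) - (shifted \<alpha> x m - shifted \<alpha> y m)"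
      using schur_L_change_last[of "M div 2" "shifted \<alpha> y" "shifted \<alpha> x" q] xac shifted_carrier e by simp
    moreover have "shifted \<alpha> x m - shifted \<alpha> y m = x M - y M"
      using xc[of m] xc[of M] yc[of M] yx[of m] by (intro eq_matI) (auto simp: shifted_def M_def)
    ultimately show ?thesis using False by (simp add: stieltjes_param_def)
  qed
  moreover have "stieltjes_param q \<alpha> x M = stieltjes_param q \<alpha> s M"
    using xs by (intro stieltjes_param_cong) auto
  ultimately show "stieltjes_param q \<alpha> t m = stieltjes_param q \<alpha> s (Suc m) -
      (s (Suc m) - s 0 * pinv (s 0) * s (Suc m) * pinv (s 0) * s 0)"
    using tp[of m] defect sM by (simp add: M_def)
qed

lemma schur_L_carrier: "h (2 * n) \<in> carrier_mat q q \<Longrightarrow> schur_L q h n \<in> carrier_mat q q"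
  by (cases n) (auto simp: schur_L_def schur_L_Suc intro!: minus_carrier_mat carrier_matI)

lemma stieltjes_param_carrier:
  assumes "\<And>j. j \<le> m \<Longrightarrow> s j \<in> carrier_mat q q"
  shows "stieltjes_param q \<alpha> s m \<in> carrier_mat q q"
proof -
  have "schur_L q s (m div 2) \<in> carrier_mat q q" using assms by (intro schur_L_carrier) auto
  moreover have "schur_L q (shifted \<alpha> s) (m div 2) \<in> carrier_mat q q" if "odd m"
    using assms that by (intro schur_L_carrier) (auto simp: shifted_def elim!: oddE)
  ultimately show ?thesis by (simp add: stieltjes_param_def)
qed

lemma schur_transform_param:
  assumes s: "s \<in> stieltjes_class q m \<alpha>" and k: "k \<le> m"
  shows "schur_transform q \<alpha> k s \<in> stieltjes_class q (m - k) \<alpha> \<and>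
    (\<forall>j < m - k. stieltjes_param q \<alpha> (schur_transform q \<alpha> k s) j = stieltjes_param q \<alpha> s (k + j)) \<and>
    stieltjes_param q \<alpha> (schur_transform q \<alpha> k s) (m - k) =
      stieltjes_param q \<alpha> s m - msum q (\<lambda>r. defect q \<alpha> s (m - r) r) {..<k}"
  using k
proof (induction k)
  case 0
  have "msum q (\<lambda>r. defect q \<alpha> s (m - r) r) {..<0} = 0\<^sub>m q q" by (rule msum_zero) simp
  moreover have "stieltjes_param q \<alpha> s m \<in> carrier_mat q q"
    using s by (intro stieltjes_param_carrier) (simp add: stieltjes_class_iff)
  ultimately show ?case using s by (auto intro!: eq_matI)
next
  case (Suc k)
  define t where "t = schur_transform q \<alpha> k s"
  define l where "l = m - Suc k"
  have l: "m - k = Suc l" using Suc.prems by (simp add: l_def)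
  have IH: "t \<in> stieltjes_class q (Suc l) \<alpha>"
    "\<And>j. j < Suc l \<Longrightarrow> stieltjes_param q \<alpha> t j = stieltjes_param q \<alpha> s (k + j)"
    "stieltjes_param q \<alpha> t (Suc l) = stieltjes_param q \<alpha> s m - msum q (\<lambda>r. defect q \<alpha> s (m - r) r) {..<k}"
    using Suc unfolding t_def[symmetric] l by auto
  define D where "D = defect q \<alpha> s (m - k) k"
  have Dt: "D = t (Suc l) - t 0 * pinv (t 0) * t (Suc l) * pinv (t 0) * t 0"
    by (simp add: D_def defect_def Let_def t_def l)
  have tc: "t j \<in> carrier_mat q q" if "j \<le> Suc l" for j using IH(1) that by (simp add: stieltjes_class_iff)
  have D: "D \<in> carrier_mat q q"
    unfolding Dt using tc[of 0] by (intro minus_carrier_mat carrier_matI) auto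
  have "msum q (\<lambda>r. defect q \<alpha> s (m - r) r) {..<Suc k} = D + msum q (\<lambda>r. defect q \<alpha> s (m - r) r) {..<k}"
    unfolding lessThan_Suc D_def by (rule msum_insert) (use D in \<open>auto simp: D_def\<close>)
  moreover have "stieltjes_param q \<alpha> s m \<in> carrier_mat q q"
    using s by (intro stieltjes_param_carrier) (simp add: stieltjes_class_iff)
  ultimately have "stieltjes_param q \<alpha> (schur_transform1 q \<alpha> t) l =
      stieltjes_param q \<alpha> s m - msum q (\<lambda>r. defect q \<alpha> s (m - r) r) {..<Suc k}"
    using schur_step(3)[OF IH(1)] IH(3) D unfolding Dt[symmetric] by (auto intro!: eq_matI)
  then show ?case
    using schur_step(1,2)[OF IH(1)] IH(2) unfolding l_def[symmetric] by (simp add: t_def[symmetric])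
qed

theorem theorem9p25:
  fixes q m k :: nat and \<alpha> :: real and s :: "nat \<Rightarrow> complex mat"
  assumes "1 \<le> q"
    and "s \<in> stieltjes_class q m \<alpha>"
    and "k \<le> m"
  shows "let t = schur_transform q \<alpha> k s;
             Q = stieltjes_param q \<alpha> s;
             T = stieltjes_param q \<alpha> t
         in T (m - k) =
              (if k = 0 then Q m
               else Q m - msum q (\<lambda>r. defect q \<alpha> s (m - r) r) {0..k - 1})
            \<and> (k < m \<longrightarrow> (\<forall>j. j \<le> m - k - 1 \<longrightarrow> T j = Q (k + j)))"
proof -
  have "{..<k} = {0..k - 1}" if "k \<noteq> 0" using that by auto
  then show ?thesis
    using schur_transform_param[OF assms(2,3)] by (auto simp: Let_def)
qed

end
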